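(* For any $k\in\{1,\dots,n-1\}$ the assignments $$u_i\mapsto\begin{cases}e_i+b_{i-1}f_{i-1}&\text{if }i<k\\ e_i+b_if_{i+1}&\text{if }i>k\\ e_k+b_{k-1}f_{k-1}+b_kf_{k+1}+b_{k-1}b_k[f_{k-1},[f_{k+1},f_k]]&\text{if }i=k\end{cases}$$ define an injective homomorphism of Lie algebras $sl_n^{(\mathbf b)}\hookrightarrow sl_n$, where $b_i:=-a_ia_{i+1}$ for parameters $a_1,\dots,a_{n-1}\in\mathbb C$ (and $b_0=b_{n-1}=0$, $f_0=f_n=0$).
   Context: $e_i=E_{i,i+1}$, $f_i=E_{i+1,i}$ are the standard Chevalley generators of $sl_n(\mathbb C)$. For $\mathbf b=(b_1,\dots,b_{n-2})\in\mathbb C^{n-2}$, $sl_n^{(\mathbf b)}$ is the Lie algebra with generators $u_1,\dots,u_{n-1}$ and relations $[u_i,u_j]=0$ for $|i-j|>1$ and $[u_i,[u_i,u_j]]=-2b_{\min(i,j)}u_i$ for $|i-j|=1$.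
   Formalization: In the case i=k the nested bracket is corrected from [f_{k-1},[f_{k+1},f_k]] to [f_{k-1},[f_k,f_{k+1}]] (a sign change), since the relations fail with the printed sign, e.g. n=4, k=2 and b_1b_2≠0; the two forms agree whenever that term vanishes. *)

theory Defs
  imports Complex_Main "Jordan_Normal_Form.VS_Connect"
begin

section \<open>Lie algebras with explicit carriers\<close>

text \<open>The multiplicative fields that the record type \<open>module\<close> inherits from \<open>ring\<close> play no role
  (they play none in the locale \<open>module\<close> either) and are left undefined in the instances below.\<close>

record ('a, 'b) lie_algebra = "('a, 'b) module" +
  lie_bracket :: "'b \<Rightarrow> 'b \<Rightarrow> 'b"

locale lie_algebra = vectorspace K L
  for K (structure) and L :: "('a, 'b, 'm) lie_algebra_scheme" (structure) +
  assumes bracket_closed: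
      "\<lbrakk>x \<in> carrier L; y \<in> carrier L\<rbrakk> \<Longrightarrow> lie_bracket L x y \<in> carrier L"
    and bracket_add_left:
      "\<lbrakk>x \<in> carrier L; y \<in> carrier L; z \<in> carrier L\<rbrakk> \<Longrightarrow>
        lie_bracket L (x \<oplus>\<^bsub>L\<^esub> y) z = lie_bracket L x z \<oplus>\<^bsub>L\<^esub> lie_bracket L y z"
    and bracket_add_right:
      "\<lbrakk>x \<in> carrier L; y \<in> carrier L; z \<in> carrier L\<rbrakk> \<Longrightarrow>
        lie_bracket L x (y \<oplus>\<^bsub>L\<^esub> z) = lie_bracket L x y \<oplus>\<^bsub>L\<^esub> lie_bracket L x z"
    and bracket_smult_left:
      "\<lbrakk>c \<in> carrier K; x \<in> carrier L; y \<in> carrier L\<rbrakk> \<Longrightarrow>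
        lie_bracket L (c \<odot>\<^bsub>L\<^esub> x) y = c \<odot>\<^bsub>L\<^esub> lie_bracket L x y"
    and bracket_smult_right:
      "\<lbrakk>c \<in> carrier K; x \<in> carrier L; y \<in> carrier L\<rbrakk> \<Longrightarrow>
        lie_bracket L x (c \<odot>\<^bsub>L\<^esub> y) = c \<odot>\<^bsub>L\<^esub> lie_bracket L x y"
    and bracket_self: "x \<in> carrier L \<Longrightarrow> lie_bracket L x x = \<zero>\<^bsub>L\<^esub>"
    and jacobi:
      "\<lbrakk>x \<in> carrier L; y \<in> carrier L; z \<in> carrier L\<rbrakk> \<Longrightarrow>
        lie_bracket L x (lie_bracket L y z) \<oplus>\<^bsub>L\<^esub>
        (lie_bracket L y (lie_bracket L z x) \<oplus>\<^bsub>L\<^esub> lie_bracket L z (lie_bracket L x y)) = \<zero>\<^bsub>L\<^esub>"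

definition lie_hom :: "('a, 'k) ring_scheme \<Rightarrow> ('a, 'b, 'm) lie_algebra_scheme \<Rightarrow>
    ('a, 'c, 'p) lie_algebra_scheme \<Rightarrow> ('b \<Rightarrow> 'c) set" where
  "lie_hom K L M = {\<phi> \<in> LinearCombinations.module_hom K L M. \<forall>x \<in> carrier L. \<forall>y \<in> carrier L.
     \<phi> (lie_bracket L x y) = lie_bracket M (\<phi> x) (\<phi> y)}"


section \<open>Lie algebras given by generators and relations\<close>

text \<open>A presented Lie algebra is the set of formal Lie expressions in the generators modulo the
  smallest congruence that contains the defining relations and the Lie algebra axioms.\<close>

datatype ('a, 'i) lie_term =
    LGen 'i
  | LZero
  | LAdd "('a, 'i) lie_term" "('a, 'i) lie_term"
  | LSmult 'a "('a, 'i) lie_term"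
  | LBracket "('a, 'i) lie_term" "('a, 'i) lie_term"

inductive_set lie_terms :: "'i set \<Rightarrow> ('a, 'i) lie_term set" for I :: "'i set" where
  term_gen: "i \<in> I \<Longrightarrow> LGen i \<in> lie_terms I"
| term_zero: "LZero \<in> lie_terms I"
| term_add: "s \<in> lie_terms I \<Longrightarrow> t \<in> lie_terms I \<Longrightarrow> LAdd s t \<in> lie_terms I"
| term_smult: "t \<in> lie_terms I \<Longrightarrow> LSmult c t \<in> lie_terms I"
| term_bracket: "s \<in> lie_terms I \<Longrightarrow> t \<in> lie_terms I \<Longrightarrow> LBracket s t \<in> lie_terms I"

inductive_set lie_cong ::
    "'i set \<Rightarrow> (('a::field, 'i) lie_term \<times> ('a, 'i) lie_term) set \<Rightarrow>
      (('a, 'i) lie_term \<times> ('a, 'i) lie_term) set"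
  for I and R where
  cong_relation: "(s, t) \<in> R \<Longrightarrow> s \<in> lie_terms I \<Longrightarrow> t \<in> lie_terms I \<Longrightarrow> (s, t) \<in> lie_cong I R"
| cong_refl: "t \<in> lie_terms I \<Longrightarrow> (t, t) \<in> lie_cong I R"
| cong_sym: "(s, t) \<in> lie_cong I R \<Longrightarrow> (t, s) \<in> lie_cong I R"
| cong_trans: "(s, t) \<in> lie_cong I R \<Longrightarrow> (t, r) \<in> lie_cong I R \<Longrightarrow> (s, r) \<in> lie_cong I R"
| cong_add: "(s, s') \<in> lie_cong I R \<Longrightarrow> (t, t') \<in> lie_cong I R \<Longrightarrow>
    (LAdd s t, LAdd s' t') \<in> lie_cong I R"
| cong_smult: "(t, t') \<in> lie_cong I R \<Longrightarrow> (LSmult c t, LSmult c t') \<in> lie_cong I R"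
| cong_bracket: "(s, s') \<in> lie_cong I R \<Longrightarrow> (t, t') \<in> lie_cong I R \<Longrightarrow>
    (LBracket s t, LBracket s' t') \<in> lie_cong I R"
| cong_add_assoc: "\<lbrakk>r \<in> lie_terms I; s \<in> lie_terms I; t \<in> lie_terms I\<rbrakk> \<Longrightarrow>
    (LAdd (LAdd r s) t, LAdd r (LAdd s t)) \<in> lie_cong I R"
| cong_add_comm: "\<lbrakk>s \<in> lie_terms I; t \<in> lie_terms I\<rbrakk> \<Longrightarrow> (LAdd s t, LAdd t s) \<in> lie_cong I R"
| cong_add_zero: "t \<in> lie_terms I \<Longrightarrow> (LAdd LZero t, t) \<in> lie_cong I R"
| cong_add_neg: "t \<in> lie_terms I \<Longrightarrow> (LAdd (LSmult (- 1) t) t, LZero) \<in> lie_cong I R"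
| cong_smult_add_left: "t \<in> lie_terms I \<Longrightarrow>
    (LSmult (c + d) t, LAdd (LSmult c t) (LSmult d t)) \<in> lie_cong I R"
| cong_smult_add_right: "\<lbrakk>s \<in> lie_terms I; t \<in> lie_terms I\<rbrakk> \<Longrightarrow>
    (LSmult c (LAdd s t), LAdd (LSmult c s) (LSmult c t)) \<in> lie_cong I R"
| cong_smult_smult: "t \<in> lie_terms I \<Longrightarrow> (LSmult (c * d) t, LSmult c (LSmult d t)) \<in> lie_cong I R"
| cong_smult_one: "t \<in> lie_terms I \<Longrightarrow> (LSmult 1 t, t) \<in> lie_cong I R"
| cong_bracket_add_left: "\<lbrakk>r \<in> lie_terms I; s \<in> lie_terms I; t \<in> lie_terms I\<rbrakk> \<Longrightarrow>
    (LBracket (LAdd r s) t, LAdd (LBracket r t) (LBracket s t)) \<in> lie_cong I R"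
| cong_bracket_add_right: "\<lbrakk>r \<in> lie_terms I; s \<in> lie_terms I; t \<in> lie_terms I\<rbrakk> \<Longrightarrow>
    (LBracket r (LAdd s t), LAdd (LBracket r s) (LBracket r t)) \<in> lie_cong I R"
| cong_bracket_smult_left: "\<lbrakk>s \<in> lie_terms I; t \<in> lie_terms I\<rbrakk> \<Longrightarrow>
    (LBracket (LSmult c s) t, LSmult c (LBracket s t)) \<in> lie_cong I R"
| cong_bracket_smult_right: "\<lbrakk>s \<in> lie_terms I; t \<in> lie_terms I\<rbrakk> \<Longrightarrow>
    (LBracket s (LSmult c t), LSmult c (LBracket s t)) \<in> lie_cong I R"
| cong_bracket_self: "t \<in> lie_terms I \<Longrightarrow> (LBracket t t, LZero) \<in> lie_cong I R"
| cong_jacobi: "\<lbrakk>r \<in> lie_terms I; s \<in> lie_terms I; t \<in> lie_terms I\<rbrakk> \<Longrightarrow>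
    (LAdd (LBracket r (LBracket s t))
      (LAdd (LBracket s (LBracket t r)) (LBracket t (LBracket r s))), LZero) \<in> lie_cong I R"

definition presented_lie_algebra ::
    "'i set \<Rightarrow> (('a::field, 'i) lie_term \<times> ('a, 'i) lie_term) set \<Rightarrow>
      ('a, ('a, 'i) lie_term set) lie_algebra" where
  "presented_lie_algebra I R =
    \<lparr> carrier = lie_terms I // lie_cong I R,
      mult = undefined,
      one = undefined,
      zero = lie_cong I R `` {LZero},
      add = (\<lambda>X Y. \<Union>s\<in>X. \<Union>t\<in>Y. lie_cong I R `` {LAdd s t}),
      smult = (\<lambda>c X. \<Union>t\<in>X. lie_cong I R `` {LSmult c t}),
      lie_bracket = (\<lambda>X Y. \<Union>s\<in>X. \<Union>t\<in>Y. lie_cong I R `` {LBracket s t}) \<rparr>"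

definition presented_gen ::
    "'i set \<Rightarrow> (('a::field, 'i) lie_term \<times> ('a, 'i) lie_term) set \<Rightarrow> 'i \<Rightarrow> ('a, 'i) lie_term set" where
  "presented_gen I R i = lie_cong I R `` {LGen i}"

lemma lie_cong_terms:
  assumes "(s, t) \<in> lie_cong I R"
  shows "s \<in> lie_terms I \<and> t \<in> lie_terms I"
  using assms by induction (auto intro: lie_terms.intros)

lemma equiv_lie_cong: "equiv (lie_terms I) (lie_cong I R)"
  by (rule equivI)
    (auto simp: refl_on_def sym_def trans_def dest: lie_cong_terms
      intro: lie_cong.cong_refl lie_cong.cong_sym lie_cong.cong_trans)

lemma presented_simps:
  "carrier (presented_lie_algebra I R) = lie_terms I // lie_cong I R"
  "zero (presented_lie_algebra I R) = lie_cong I R `` {LZero}"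
  by (simp_all add: presented_lie_algebra_def)

lemma presented_add:
  assumes "s \<in> lie_terms I" "t \<in> lie_terms I"
  shows "lie_cong I R `` {s} \<oplus>\<^bsub>presented_lie_algebra I R\<^esub> lie_cong I R `` {t}
    = lie_cong I R `` {LAdd s t}"
  unfolding presented_lie_algebra_def
  by (simp, rule UN_equiv_class2[OF equiv_lie_cong equiv_lie_cong])
    (auto simp: congruent2_def assms intro!: equiv_class_eq[OF equiv_lie_cong] lie_cong.cong_add)

lemma presented_smult:
  assumes "t \<in> lie_terms I"
  shows "c \<odot>\<^bsub>presented_lie_algebra I R\<^esub> (lie_cong I R `` {t}) = lie_cong I R `` {LSmult c t}"
  unfolding presented_lie_algebra_def
  by (simp, rule UN_equiv_class[OF equiv_lie_cong])
    (auto simp: congruent_def assms intro!: equiv_class_eq[OF equiv_lie_cong] lie_cong.cong_smult)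

lemma presented_bracket:
  assumes "s \<in> lie_terms I" "t \<in> lie_terms I"
  shows "lie_bracket (presented_lie_algebra I R) (lie_cong I R `` {s}) (lie_cong I R `` {t})
    = lie_cong I R `` {LBracket s t}"
  unfolding presented_lie_algebra_def
  by (simp, rule UN_equiv_class2[OF equiv_lie_cong equiv_lie_cong])
    (auto simp: congruent2_def assms intro!: equiv_class_eq[OF equiv_lie_cong] lie_cong.cong_bracket)

lemma presented_lie_algebra_is_lie_algebra:
  fixes R :: "(('a::field, 'i) lie_term \<times> ('a, 'i) lie_term) set"
  shows "lie_algebra (class_ring :: 'a ring) (presented_lie_algebra I R)"
proof -
  let ?L = "presented_lie_algebra I R"
  let ?C = "\<lambda>t. lie_cong I R `` {t}"
  have rep: "\<exists>t \<in> lie_terms I. X = ?C t" if "X \<in> carrier ?L" for X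
    using that by (auto simp: presented_simps elim: quotientE)
  have closed: "?C t \<in> carrier ?L" if "t \<in> lie_terms I" for t
    using that by (auto simp: presented_simps intro: quotientI)
  note simps = presented_simps(2) presented_add presented_smult presented_bracket closed
    lie_terms.intros
  note eqs = lie_cong.intros(8,10-)[THEN equiv_class_eq[OF equiv_lie_cong]]
  have group: "abelian_group ?L"
  proof (rule abelian_groupI)
    fix X assume "X \<in> carrier ?L"
    then obtain t where t: "t \<in> lie_terms I" "X = ?C t" using rep by blast
    have "?C (LSmult (- 1) t) \<oplus>\<^bsub>?L\<^esub> X = \<zero>\<^bsub>?L\<^esub>"
      using t by (simp add: simps eqs)
    then show "\<exists>Y \<in> carrier ?L. Y \<oplus>\<^bsub>?L\<^esub> X = \<zero>\<^bsub>?L\<^esub>"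
      by (rule bexI) (rule closed[OF lie_terms.term_smult[OF t(1)]])
  next
    show "\<zero>\<^bsub>?L\<^esub> \<in> carrier ?L" by (simp add: simps)
  next
    fix X Y assume "X \<in> carrier ?L" "Y \<in> carrier ?L"
    then obtain s t where st: "s \<in> lie_terms I" "t \<in> lie_terms I" and XY: "X = ?C s" "Y = ?C t"
      using rep[of X] rep[of Y] by blast
    show "X \<oplus>\<^bsub>?L\<^esub> Y = Y \<oplus>\<^bsub>?L\<^esub> X"
      unfolding XY presented_add[OF st] presented_add[OF st(2,1)]
      by (rule equiv_class_eq[OF equiv_lie_cong lie_cong.cong_add_comm[OF st]])
  qed ((drule rep)+, elim bexE, simp add: simps eqs)+
  have field: "field (class_ring :: 'a ring)" by (rule class_field)
  then have cring: "cring (class_ring :: 'a ring)" by (simp add: field_def domain_def)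
  have module: "module (class_ring :: 'a ring) ?L"
    by (rule moduleI, rule cring, rule group)
      ((drule rep)+, elim bexE, simp add: simps eqs)+
  show ?thesis
    by (intro lie_algebra.intro vectorspace.intro module field lie_algebra_axioms.intro)
      ((drule rep)+, elim bexE, simp add: simps eqs)+
qed


section \<open>The Lie algebra \<open>sl\<^sub>n\<close> of traceless matrices\<close>

definition sl :: "nat \<Rightarrow> (complex, complex mat) lie_algebra" where
  "sl n =
    \<lparr> carrier = {A \<in> carrier_mat n n. (\<Sum>i<n. A $$ (i, i)) = 0},
      mult = undefined,
      one = undefined,
      zero = 0\<^sub>m n n,
      add = (+),
      smult = (\<cdot>\<^sub>m),
      lie_bracket = (\<lambda>A B. A * B - B * A) \<rparr>"

text \<open>Matrix units are indexed from 1, whereas the entries of matrices are indexed from 0.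
  The matrix unit is 0 if an index lies outside \<open>{1..n}\<close>; hence \<open>chev_f n 0 = chev_f n n = 0\<close>.\<close>

definition mat_unit :: "nat \<Rightarrow> nat \<Rightarrow> nat \<Rightarrow> complex mat" where
  "mat_unit n i j = mat n n (\<lambda>(r, c). if Suc r = i \<and> Suc c = j then 1 else 0)"

definition chev_e :: "nat \<Rightarrow> nat \<Rightarrow> complex mat" where
  "chev_e n i = mat_unit n i (i + 1)"

definition chev_f :: "nat \<Rightarrow> nat \<Rightarrow> complex mat" where
  "chev_f n i = mat_unit n (i + 1) i"

lemma chev_f_boundary: "chev_f n 0 = 0\<^sub>m n n" "chev_f n n = 0\<^sub>m n n"
  by (auto simp: chev_f_def mat_unit_def)

lemma sl_is_lie_algebra: "lie_algebra (class_ring :: complex ring) (sl n)"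
proof -
  have commutator_trace: "(\<Sum>i<n. (A * B - B * A) $$ (i, i)) = 0"
    if "A \<in> carrier_mat n n" "B \<in> carrier_mat n n" for A B :: "complex mat"
  proof -
    have "(\<Sum>i<n. (A * B) $$ (i, i)) = (\<Sum>i<n. \<Sum>j<n. A $$ (i, j) * B $$ (j, i))"
      using that by (auto simp: scalar_prod_def lessThan_atLeast0 intro!: sum.cong)
    also have "\<dots> = (\<Sum>j<n. \<Sum>i<n. B $$ (j, i) * A $$ (i, j))"
      by (subst sum.swap) (simp add: mult.commute)
    also have "\<dots> = (\<Sum>j<n. (B * A) $$ (j, j))"
      using that by (auto simp: scalar_prod_def lessThan_atLeast0 intro!: sum.cong)
    finally show ?thesis
      using that by (simp add: sum_subtractf)
  qed
  have group: "abelian_group (sl n)"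
  proof (rule abelian_groupI)
    fix A assume A: "A \<in> carrier (sl n)"
    then have "- A \<in> carrier (sl n)" "- A \<oplus>\<^bsub>sl n\<^esub> A = \<zero>\<^bsub>sl n\<^esub>"
      by (auto simp: sl_def sum_negf)
    then show "\<exists>B \<in> carrier (sl n). B \<oplus>\<^bsub>sl n\<^esub> A = \<zero>\<^bsub>sl n\<^esub>" by blast
  qed (auto simp: sl_def sum.distrib comm_add_mat)
  have field: "field (class_ring :: complex ring)" by (rule class_field)
  then have cring: "cring (class_ring :: complex ring)" by (simp add: field_def domain_def)
  have module: "module (class_ring :: complex ring) (sl n)"
  proof (rule moduleI)
    show "cring (class_ring :: complex ring)" by (rule cring)
    show "abelian_group (sl n)" by (rule group)
  qed (auto simp: sl_def add_smult_distrib_left_mat add_smult_distrib_right_mat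
      simp flip: sum_distrib_left)
  have car: "A \<in> carrier_mat n n" if "A \<in> carrier (sl n)" for A
    using that by (simp add: sl_def)
  note distribs = add_mult_distrib_mat[of _ n n _ _ n] mult_add_distrib_mat[of _ n n _ n]
    minus_mult_distrib_mat[of _ n n _ _ n] mult_minus_distrib_mat[of _ n n _ n]
    assoc_mult_mat[of _ n n _ n _ n]
  show ?thesis
  proof (intro lie_algebra.intro vectorspace.intro module field lie_algebra_axioms.intro)
    fix A B assume "A \<in> carrier (sl n)" "B \<in> carrier (sl n)"
    then show "lie_bracket (sl n) A B \<in> carrier (sl n)"
      using commutator_trace[of A B] by (auto simp: sl_def)
  next
    fix A B C assume "A \<in> carrier (sl n)" "B \<in> carrier (sl n)" "C \<in> carrier (sl n)"
    then have ABC: "A \<in> carrier_mat n n" "B \<in> carrier_mat n n" "C \<in> carrier_mat n n"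
      by (auto dest: car)
    note [simp] = ABC ABC[THEN carrier_matD(1)] ABC[THEN carrier_matD(2)]
    show "lie_bracket (sl n) (A \<oplus>\<^bsub>sl n\<^esub> B) C = lie_bracket (sl n) A C \<oplus>\<^bsub>sl n\<^esub> lie_bracket (sl n) B C"
      "lie_bracket (sl n) A (B \<oplus>\<^bsub>sl n\<^esub> C) = lie_bracket (sl n) A B \<oplus>\<^bsub>sl n\<^esub> lie_bracket (sl n) A C"
      "lie_bracket (sl n) A (lie_bracket (sl n) B C) \<oplus>\<^bsub>sl n\<^esub>
        (lie_bracket (sl n) B (lie_bracket (sl n) C A) \<oplus>\<^bsub>sl n\<^esub>
         lie_bracket (sl n) C (lie_bracket (sl n) A B)) = \<zero>\<^bsub>sl n\<^esub>"
      by (simp_all add: sl_def distribs mult_carrier_mat[of _ n n _ n] minus_carrier_mat)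
        (intro eq_matI; simp)+
  next
    fix c :: complex and A B assume "A \<in> carrier (sl n)" "B \<in> carrier (sl n)"
    then have AB: "A \<in> carrier_mat n n" "B \<in> carrier_mat n n"
      by (auto dest: car)
    note [simp] = AB AB[THEN carrier_matD(1)] AB[THEN carrier_matD(2)]
    show "lie_bracket (sl n) (c \<odot>\<^bsub>sl n\<^esub> A) B = c \<odot>\<^bsub>sl n\<^esub> lie_bracket (sl n) A B"
      "lie_bracket (sl n) A (c \<odot>\<^bsub>sl n\<^esub> B) = c \<odot>\<^bsub>sl n\<^esub> lie_bracket (sl n) A B"
      by (auto simp: sl_def mult_smult_assoc_mat[of _ n n _ n] mult_smult_distrib[of _ n n _ n]
          algebra_simps intro!: eq_matI)
  next
    fix A assume "A \<in> carrier (sl n)"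
    then show "lie_bracket (sl n) A A = \<zero>\<^bsub>sl n\<^esub>"
      using minus_r_inv_mat[of "A * A" n n] by (auto dest!: car simp: sl_def)
  qed
qed


section \<open>The Lie algebra \<open>sl\<^sub>n\<^sup>b\<close>\<close>

definition sl_b_relations ::
    "nat \<Rightarrow> (nat \<Rightarrow> complex) \<Rightarrow> ((complex, nat) lie_term \<times> (complex, nat) lie_term) set" where
  "sl_b_relations n b =
    {(LBracket (LGen i) (LGen j), LZero) | i j.
       i \<in> {1..n-1} \<and> j \<in> {1..n-1} \<and> \<bar>int i - int j\<bar> > 1} \<union>
    {(LBracket (LGen i) (LBracket (LGen i) (LGen j)), LSmult (- 2 * b (min i j)) (LGen i)) | i j.
       i \<in> {1..n-1} \<and> j \<in> {1..n-1} \<and> \<bar>int i - int j\<bar> = 1}"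

definition sl_b :: "nat \<Rightarrow> (nat \<Rightarrow> complex) \<Rightarrow> (complex, (complex, nat) lie_term set) lie_algebra" where
  "sl_b n b = presented_lie_algebra {1..n-1} (sl_b_relations n b)"

definition sl_b_gen :: "nat \<Rightarrow> (nat \<Rightarrow> complex) \<Rightarrow> nat \<Rightarrow> (complex, nat) lie_term set" where
  "sl_b_gen n b = presented_gen {1..n-1} (sl_b_relations n b)"

text \<open>The sign of the term of degree two in \<open>b\<close> depends on the order of the factors of the nested
  bracket. For \<open>e\<^sub>i = E\<^sub>i\<^sub>,\<^sub>i\<^sub>+\<^sub>1\<close> and \<open>f\<^sub>i = E\<^sub>i\<^sub>+\<^sub>1\<^sub>,\<^sub>i\<close> one has
  \<open>[f\<^sub>k\<^sub>-\<^sub>1, [f\<^sub>k\<^sub>+\<^sub>1, f\<^sub>k]] = - E\<^sub>k\<^sub>+\<^sub>2\<^sub>,\<^sub>k\<^sub>-\<^sub>1\<close>, and the relations between \<open>u\<^sub>k\<close> and its neighbours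
  hold only if this bracket has the coefficient \<open>- b\<^sub>k\<^sub>-\<^sub>1 b\<^sub>k\<close>, i.e. if the term is
  \<open>b\<^sub>k\<^sub>-\<^sub>1 b\<^sub>k [f\<^sub>k\<^sub>-\<^sub>1, [f\<^sub>k, f\<^sub>k\<^sub>+\<^sub>1]]\<close>. The form \<open>b\<^sub>k\<^sub>-\<^sub>1 b\<^sub>k [f\<^sub>k\<^sub>-\<^sub>1, [f\<^sub>k\<^sub>+\<^sub>1, f\<^sub>k]]\<close>
  of the source has the wrong sign: \<open>gen_image_sign\<close> below shows that it fails
  for \<open>n = 4\<close>, \<open>k = 2\<close> as soon as \<open>b\<^sub>1 b\<^sub>2 \<noteq> 0\<close>.\<close>

definition gen_image :: "nat \<Rightarrow> nat \<Rightarrow> (nat \<Rightarrow> complex) \<Rightarrow> nat \<Rightarrow> complex mat" where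
  "gen_image n k b i =
    (let e = chev_e n; f = chev_f n in
      if i < k then e i + b (i - 1) \<cdot>\<^sub>m f (i - 1)
      else if i > k then e i + b i \<cdot>\<^sub>m f (i + 1)
      else e k + b (k - 1) \<cdot>\<^sub>m f (k - 1) + b k \<cdot>\<^sub>m f (k + 1)
        + (b (k - 1) * b k) \<cdot>\<^sub>m
            lie_bracket (sl n) (f (k - 1)) (lie_bracket (sl n) (f k) (f (k + 1))))"

lemma sl_b_bracket_relation:
  assumes "i \<in> {1..n-1}" "j \<in> {1..n-1}" "\<bar>int i - int j\<bar> = 1"
  shows "lie_bracket (sl_b n b) (sl_b_gen n b i)
      (lie_bracket (sl_b n b) (sl_b_gen n b i) (sl_b_gen n b j)) =
    (- 2 * b (min i j)) \<odot>\<^bsub>sl_b n b\<^esub> sl_b_gen n b i"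
proof -
  have gens: "LGen i \<in> lie_terms {1..n-1}" "LGen j \<in> lie_terms {1..n-1}"
    using assms by (auto intro: lie_terms.term_gen)
  have "(LBracket (LGen i) (LBracket (LGen i) (LGen j)), LSmult (- 2 * b (min i j)) (LGen i))
      \<in> lie_cong {1..n-1} (sl_b_relations n b)"
    by (rule lie_cong.cong_relation) (use assms gens in \<open>auto simp: sl_b_relations_def intro!: lie_terms.intros\<close>)
  from equiv_class_eq[OF equiv_lie_cong this] show ?thesis
    unfolding sl_b_def sl_b_gen_def presented_gen_def presented_bracket[OF gens]
      presented_bracket[OF gens(1) lie_terms.term_bracket[OF gens]] presented_smult[OF gens(1)] .
qed

lemma sl_b_gen_closed: "i \<in> {1..n-1} \<Longrightarrow> sl_b_gen n b i \<in> carrier (sl_b n b)"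
  unfolding sl_b_def sl_b_gen_def presented_gen_def presented_simps
  by (intro quotientI lie_terms.term_gen)

lemma gen_image_sign:
  fixes c :: complex
  assumes hom: "\<phi> \<in> lie_hom class_ring (sl_b 4 b) (sl 4)"
    and 1: "\<phi> (sl_b_gen 4 b 1) = chev_e 4 1"
    and 2: "\<phi> (sl_b_gen 4 b 2) = chev_e 4 2 + b 1 \<cdot>\<^sub>m chev_f 4 1 + b 2 \<cdot>\<^sub>m chev_f 4 3
      + c \<cdot>\<^sub>m lie_bracket (sl 4) (chev_f 4 1) (lie_bracket (sl 4) (chev_f 4 3) (chev_f 4 2))"
  shows "c = - (b 1 * b 2)"
proof -
  interpret L: lie_algebra class_ring "sl_b 4 b"
    unfolding sl_b_def by (rule presented_lie_algebra_is_lie_algebra)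
  let ?U = "\<phi> (sl_b_gen 4 b 2)" and ?V = "\<phi> (sl_b_gen 4 b 1)"
  have gens: "sl_b_gen 4 b 1 \<in> carrier (sl_b 4 b)" "sl_b_gen 4 b 2 \<in> carrier (sl_b 4 b)"
    by (auto intro: sl_b_gen_closed)
  have "lie_bracket (sl 4) ?U (lie_bracket (sl 4) ?U ?V) =
      \<phi> (lie_bracket (sl_b 4 b) (sl_b_gen 4 b 2)
        (lie_bracket (sl_b 4 b) (sl_b_gen 4 b 2) (sl_b_gen 4 b 1)))"
    using hom gens by (simp add: lie_hom_def L.bracket_closed)
  also have "\<dots> = \<phi> ((- 2 * b 1) \<odot>\<^bsub>sl_b 4 b\<^esub> sl_b_gen 4 b 2)"
    by (subst sl_b_bracket_relation) auto
  also have "\<dots> = (- 2 * b 1) \<odot>\<^bsub>sl 4\<^esub> ?U"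
    using hom gens by (simp add: lie_hom_def LinearCombinations.module_hom_def)
  finally have eq: "lie_bracket (sl 4) ?U (lie_bracket (sl 4) ?U ?V) = (- 2 * b 1) \<odot>\<^bsub>sl 4\<^esub> ?U" .
  let ?M = "\<lambda>rows :: complex list list. mat 4 4 (\<lambda>(i, j). rows ! i ! j)"
  have mult4: "(A * B) $$ (i, j) = A $$ (i, 0) * B $$ (0, j) + A $$ (i, 1) * B $$ (1, j)
      + A $$ (i, 2) * B $$ (2, j) + A $$ (i, 3) * B $$ (3, j)"
    if "A \<in> carrier_mat 4 4" "B \<in> carrier_mat 4 4" "i < 4" "j < 4" for A B :: "complex mat" and i j
    using that by (simp add: scalar_prod_def eval_nat_numeral)
  have ext4: "A = B" if "A \<in> carrier_mat 4 4" "B \<in> carrier_mat 4 4"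
    and "\<And>i j. i \<in> {0, 1, 2, 3} \<Longrightarrow> j \<in> {0, 1, 2, 3} \<Longrightarrow> A $$ (i, j) = B $$ (i, j)"
    for A B :: "complex mat"
  proof (rule eq_matI)
    fix i j assume "i < dim_row B" "j < dim_col B"
    then have "i \<in> {0, 1, 2, 3}" "j \<in> {0, 1, 2, 3}" using that(2) by auto
    then show "A $$ (i, j) = B $$ (i, j)" by (rule that(3))
  qed (use that in auto)
  note entry = chev_e_def chev_f_def mat_unit_def
  have F: "lie_bracket (sl 4) (chev_f 4 3) (chev_f 4 2) =
      ?M [[0,0,0,0], [0,0,0,0], [0,0,0,0], [0,1,0,0]]"
    by (rule ext4) (auto simp: sl_def mult4 entry simp del: index_mult_mat(1))
  have V: "?V = ?M [[0,1,0,0], [0,0,0,0], [0,0,0,0], [0,0,0,0]]"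
    unfolding 1 by (rule ext4) (auto simp: entry)
  have U: "?U = ?M [[0,0,0,0], [b 1,0,1,0], [0,0,0,0], [-c,0,b 2,0]]"
    unfolding 2 F by (rule ext4) (auto simp: sl_def mult4 entry simp del: index_mult_mat(1))
  have W: "lie_bracket (sl 4) ?U ?V = ?M [[-b 1,0,-1,0], [0,b 1,0,0], [0,0,0,0], [0,-c,0,0]]"
    unfolding U V by (rule ext4) (auto simp: sl_def mult4 simp del: index_mult_mat(1))
  have "lie_bracket (sl 4) ?U (lie_bracket (sl 4) ?U ?V) $$ (3, 2) = 2 * c"
    unfolding W unfolding U by (simp add: sl_def mult4 del: index_mult_mat(1))
  moreover have "((- 2 * b 1) \<odot>\<^bsub>sl 4\<^esub> ?U) $$ (3, 2) = - 2 * (b 1 * b 2)"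
    unfolding U by (simp add: sl_def)
  ultimately have "2 * c = - 2 * (b 1 * b 2)"
    unfolding eq by simp
  then show ?thesis by (metis mult_left_cancel mult_minus_left mult_minus_right zero_neq_numeral)
qed

end

theory Submission
  imports Defs
begin

text \<open>Write \<open>u\<^sub>i\<^sub>,\<^sub>d = [u\<^sub>i, [u\<^sub>i\<^sub>+\<^sub>1, \<dots>, u\<^sub>i\<^sub>+\<^sub>d]]\<close>. The relations of \<open>sl\<^sub>n\<^sup>b\<close> deform the Serre relations
  of the strictly upper triangular matrices, and the span of all \<open>u\<^sub>i\<^sub>,\<^sub>d\<close> is still stable
  under bracketing with each generator, so it is everything. In \<open>sl\<^sub>n\<close> the image of \<open>u\<^sub>i\<close> is a rank one
  matrix \<open>v\<^sub>i w\<^sub>i\<^sup>T\<close>; the relations reduce to \<open>w\<^sub>i\<^sup>T v\<^sub>j = 0\<close> for \<open>|i - j| \<noteq> 1\<close> and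
  \<open>(w\<^sub>i\<^sup>T v\<^sub>j) (w\<^sub>j\<^sup>T v\<^sub>i) = b\<^sub>m\<^sub>i\<^sub>n\<^sub>(\<^sub>i\<^sub>,\<^sub>j\<^sub>)\<close> for \<open>|i - j| = 1\<close>. The image of \<open>u\<^sub>i\<^sub>,\<^sub>d\<close> is
  \<open>E\<^sub>i\<^sub>,\<^sub>i\<^sub>+\<^sub>d\<^sub>+\<^sub>1\<close> plus matrices supported on strictly lower diagonals, so these images are
  linearly independent and the homomorphism is injective.\<close>

section \<open>Brackets and submodules\<close>

context lie_algebra
begin

lemma bracket_zero_right: "x \<in> carrier L \<Longrightarrow> lie_bracket L x \<zero>\<^bsub>L\<^esub> = \<zero>\<^bsub>L\<^esub>"
  using bracket_smult_right[of "\<zero>" x "\<zero>\<^bsub>L\<^esub>"] by (simp add: bracket_closed)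

lemma bracket_zero_left: "x \<in> carrier L \<Longrightarrow> lie_bracket L \<zero>\<^bsub>L\<^esub> x = \<zero>\<^bsub>L\<^esub>"
  using bracket_smult_left[of "\<zero>" "\<zero>\<^bsub>L\<^esub>" x] by (simp add: bracket_closed)

lemma bracket_swap:
  assumes x: "x \<in> carrier L" and y: "y \<in> carrier L"
  shows "lie_bracket L x y = \<ominus>\<^bsub>L\<^esub> lie_bracket L y x"
proof -
  have "lie_bracket L x y \<oplus>\<^bsub>L\<^esub> lie_bracket L y x =
      lie_bracket L (x \<oplus>\<^bsub>L\<^esub> y) (x \<oplus>\<^bsub>L\<^esub> y)"
    using x y
    by (simp add: bracket_add_left bracket_add_right bracket_closed bracket_self[of x]
        bracket_self[of y] M.a_comm)
  also have "\<dots> = \<zero>\<^bsub>L\<^esub>"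
    using x y by (intro bracket_self) simp
  finally have "lie_bracket L x y \<oplus>\<^bsub>L\<^esub> lie_bracket L y x = \<zero>\<^bsub>L\<^esub>" .
  then show ?thesis
    using x y by (intro M.minus_equality[symmetric]) (auto simp: bracket_closed)
qed

lemma bracket_neg_right:
  assumes x: "x \<in> carrier L" and y: "y \<in> carrier L"
  shows "lie_bracket L x (\<ominus>\<^bsub>L\<^esub> y) = \<ominus>\<^bsub>L\<^esub> lie_bracket L x y"
proof -
  have "lie_bracket L x (\<ominus>\<^bsub>L\<^esub> y) \<oplus>\<^bsub>L\<^esub> lie_bracket L x y = \<zero>\<^bsub>L\<^esub>"
    using x y by (simp add: bracket_add_right[symmetric] M.l_neg bracket_zero_right)
  then show ?thesis
    using x y by (intro M.minus_equality[symmetric]) (auto simp: bracket_closed)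
qed

text \<open>Antisymmetry reverses two brackets in \<open>jacobi\<close>, so bracketing with
  \<open>x\<close> is a derivation. The chain computations below use the Jacobi identity in this
  form.\<close>

lemma bracket_leibniz:
  assumes x: "x \<in> carrier L" and y: "y \<in> carrier L" and z: "z \<in> carrier L"
  shows "lie_bracket L x (lie_bracket L y z) =
    lie_bracket L (lie_bracket L x y) z \<oplus>\<^bsub>L\<^esub> lie_bracket L y (lie_bracket L x z)"
proof -
  define A B C where "A = lie_bracket L x (lie_bracket L y z)"
    and "B = lie_bracket L y (lie_bracket L x z)" and "C = lie_bracket L (lie_bracket L x y) z"
  have ABC: "A \<in> carrier L" "B \<in> carrier L" "C \<in> carrier L"
    using x y z by (auto simp: A_def B_def C_def bracket_closed)
  have "lie_bracket L y (lie_bracket L z x) = \<ominus>\<^bsub>L\<^esub> B"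
    unfolding B_def using x y z bracket_swap[OF z x] by (simp add: bracket_closed bracket_neg_right)
  moreover have "lie_bracket L z (lie_bracket L x y) = \<ominus>\<^bsub>L\<^esub> C"
    unfolding C_def using x y z by (intro bracket_swap) (auto simp: bracket_closed)
  ultimately have "A \<oplus>\<^bsub>L\<^esub> (\<ominus>\<^bsub>L\<^esub> B \<oplus>\<^bsub>L\<^esub> \<ominus>\<^bsub>L\<^esub> C) = \<zero>\<^bsub>L\<^esub>"
    using jacobi[OF x y z] by (simp add: A_def)
  then have "A \<oplus>\<^bsub>L\<^esub> \<ominus>\<^bsub>L\<^esub> (C \<oplus>\<^bsub>L\<^esub> B) = \<zero>\<^bsub>L\<^esub>"
    using ABC by (simp add: M.minus_add M.a_comm)
  then have "A = C \<oplus>\<^bsub>L\<^esub> B"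
    using ABC M.r_neg M.add.inv_closed by (metis M.add.m_closed M.minus_equality M.minus_minus)
  then show ?thesis by (simp add: A_def B_def C_def)
qed

lemma submodule_neg:
  assumes "submodule K N L" "x \<in> N"
  shows "\<ominus>\<^bsub>L\<^esub> x \<in> N"
proof -
  interpret N: submodule K N L by fact
  have "(\<ominus> \<one>) \<odot>\<^bsub>L\<^esub> x \<in> N" using assms(2) by simp
  moreover have "(\<ominus> \<one>) \<odot>\<^bsub>L\<^esub> x = \<ominus>\<^bsub>L\<^esub> x"
    using assms(2) N.subset smult_l_minus[of \<one> x] by auto
  ultimately show ?thesis by simp
qed

text \<open>The elements that bracketing with \<open>x\<close> sends into \<open>N\<close> form a
  submodule, so it suffices to test the set \<open>A\<close>.\<close>

lemma bracket_span:
  assumes N: "submodule K N L" and x: "x \<in> carrier L" and A: "A \<subseteq> carrier L"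
    and gen: "\<And>y. y \<in> A \<Longrightarrow> lie_bracket L x y \<in> N"
    and y: "y \<in> span A"
  shows "lie_bracket L x y \<in> N"
proof -
  interpret N: submodule K N L by fact
  have "submodule K {y \<in> carrier L. lie_bracket L x y \<in> N} L"
    by (intro submodule.intro module_axioms)
      (auto simp: x bracket_add_right bracket_smult_right bracket_zero_right)
  moreover have "A \<subseteq> {y \<in> carrier L. lie_bracket L x y \<in> N}" using A gen by auto
  ultimately have "span A \<subseteq> {y \<in> carrier L. lie_bracket L x y \<in> N}"
    by (intro span_is_subset)
  then show ?thesis using y by auto
qed

end

section \<open>Homomorphisms from presented Lie algebras\<close>

primrec lie_eval ::
    "('a, 'b, 'm) lie_algebra_scheme \<Rightarrow> ('i \<Rightarrow> 'b) \<Rightarrow> ('a, 'i) lie_term \<Rightarrow> 'b" where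
  "lie_eval M g (LGen i) = g i"
| "lie_eval M g LZero = \<zero>\<^bsub>M\<^esub>"
| "lie_eval M g (LAdd s t) = lie_eval M g s \<oplus>\<^bsub>M\<^esub> lie_eval M g t"
| "lie_eval M g (LSmult c t) = c \<odot>\<^bsub>M\<^esub> lie_eval M g t"
| "lie_eval M g (LBracket s t) = lie_bracket M (lie_eval M g s) (lie_eval M g t)"

context
  fixes M :: "('a::field, 'b, 'm) lie_algebra_scheme" and g :: "'i \<Rightarrow> 'b" and I :: "'i set"
  assumes M: "lie_algebra (class_ring :: 'a ring) M"
    and g: "\<And>i. i \<in> I \<Longrightarrow> g i \<in> carrier M"
begin

interpretation M: lie_algebra "class_ring :: 'a ring" M by (rule M)

lemma lie_eval_closed: "t \<in> lie_terms I \<Longrightarrow> lie_eval M g t \<in> carrier M"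
  by (induction rule: lie_terms.induct) (auto simp: g M.bracket_closed M.smult_closed)

text \<open>Apart from \<open>R\<close>, the clauses of the congruence are closure rules or Lie
  algebra axioms, all valid in \<open>M\<close>. Evaluation therefore descends to the quotient once
  it respects \<open>R\<close>.\<close>

lemma lie_eval_cong:
  assumes "(s, t) \<in> lie_cong I R"
    and rel: "\<And>s t. (s, t) \<in> R \<Longrightarrow> lie_eval M g s = lie_eval M g t"
  shows "lie_eval M g s = lie_eval M g t"
  using assms(1)
proof induction
  case (cong_relation s t)
  show ?case by (rule rel[OF cong_relation(1)])
next
  case (cong_add_neg t)
  then have t: "lie_eval M g t \<in> carrier M" by (rule lie_eval_closed)
  have "((- 1) \<odot>\<^bsub>M\<^esub> lie_eval M g t) \<oplus>\<^bsub>M\<^esub> lie_eval M g t =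
      ((- 1) \<odot>\<^bsub>M\<^esub> lie_eval M g t) \<oplus>\<^bsub>M\<^esub> (1 \<odot>\<^bsub>M\<^esub> lie_eval M g t)"
    using M.smult_one[OF t] by simp
  also have "\<dots> = (- 1 + 1) \<odot>\<^bsub>M\<^esub> lie_eval M g t"
    using M.smult_l_distr[of "- 1" 1, OF _ _ t] by simp
  also have "\<dots> = \<zero>\<^bsub>M\<^esub>" using M.smult_l_null[OF t] by simp
  finally show ?case by simp
next
  case (cong_add_assoc r s t)
  then show ?case by (simp add: lie_eval_closed M.a_assoc)
next
  case (cong_add_comm s t)
  then show ?case by (simp add: lie_eval_closed M.a_comm)
next
  case (cong_smult_smult t c d)
  then show ?case using M.smult_assoc1[of c d] by (simp add: lie_eval_closed)
next
  case (cong_smult_add_left t c d)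
  then show ?case using M.smult_l_distr[of c d] by (simp add: lie_eval_closed)
next
  case (cong_smult_one t)
  then show ?case using M.smult_one by (simp add: lie_eval_closed)
qed (simp_all add: lie_eval_closed M.smult_r_distr M.bracket_add_left M.bracket_add_right
    M.bracket_smult_left M.bracket_smult_right M.bracket_self M.jacobi)

end

lemma presented_carrierE:
  assumes "x \<in> carrier (presented_lie_algebra I R)"
  obtains t where "t \<in> lie_terms I" "x = lie_cong I R `` {t}"
  using assms by (auto simp: presented_simps elim: quotientE)

lemma lie_class_closed:
  "t \<in> lie_terms I \<Longrightarrow> lie_cong I R `` {t} \<in> carrier (presented_lie_algebra I R)"
  by (auto simp: presented_simps intro: quotientI)

lemma presented_hom_exists:
  fixes M :: "('a::field, 'b, 'm) lie_algebra_scheme" and g :: "'i \<Rightarrow> 'b"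
  assumes M: "lie_algebra (class_ring :: 'a ring) M"
    and g: "\<And>i. i \<in> I \<Longrightarrow> g i \<in> carrier M"
    and rel: "\<And>s t. (s, t) \<in> R \<Longrightarrow> lie_eval M g s = lie_eval M g t"
  shows "\<exists>\<phi> \<in> lie_hom class_ring (presented_lie_algebra I R) M.
    \<forall>i \<in> I. \<phi> (presented_gen I R i) = g i"
proof -
  let ?C = "\<lambda>t. lie_cong I R `` {t}"
  \<comment> \<open>Evaluation is constant on each class, so the image of a class is a singleton and
    \<open>the_elem\<close> extracts its value.\<close>
  define \<phi> where "\<phi> X = the_elem (lie_eval M g ` X)" for X
  have \<phi>: "\<phi> (?C t) = lie_eval M g t" if "t \<in> lie_terms I" for t
  proof -
    have "lie_eval M g ` ?C t = {lie_eval M g t}"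
    proof (intro equalityI subsetI)
      fix y assume "y \<in> lie_eval M g ` ?C t"
      then obtain s where "(t, s) \<in> lie_cong I R" "y = lie_eval M g s" by auto
      moreover have "lie_eval M g t = lie_eval M g s"
        using M g \<open>(t, s) \<in> lie_cong I R\<close> rel by (rule lie_eval_cong)
      ultimately show "y \<in> {lie_eval M g t}" by simp
    qed (use lie_cong.cong_refl[OF that, of R] in blast)
    then show ?thesis by (simp add: \<phi>_def)
  qed
  have "\<phi> \<in> lie_hom class_ring (presented_lie_algebra I R) M"
    unfolding lie_hom_def LinearCombinations.module_hom_def
    by (auto elim!: presented_carrierE simp: presented_add presented_smult presented_bracket \<phi>
        lie_terms.intros lie_eval_closed[OF M g])
  moreover have "\<phi> (presented_gen I R i) = g i" if "i \<in> I" for i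
    using \<phi>[OF lie_terms.term_gen[OF that]] by (simp add: presented_gen_def)
  ultimately show ?thesis by blast
qed

lemma lie_homD:
  assumes "\<phi> \<in> lie_hom K L M"
  shows "x \<in> carrier L \<Longrightarrow> \<phi> x \<in> carrier M"
    and "x \<in> carrier L \<Longrightarrow> y \<in> carrier L \<Longrightarrow> \<phi> (x \<oplus>\<^bsub>L\<^esub> y) = \<phi> x \<oplus>\<^bsub>M\<^esub> \<phi> y"
    and "c \<in> carrier K \<Longrightarrow> x \<in> carrier L \<Longrightarrow> \<phi> (c \<odot>\<^bsub>L\<^esub> x) = c \<odot>\<^bsub>M\<^esub> \<phi> x"
    and "x \<in> carrier L \<Longrightarrow> y \<in> carrier L \<Longrightarrow> \<phi> (lie_bracket L x y) = lie_bracket M (\<phi> x) (\<phi> y)"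
  using assms by (auto simp: lie_hom_def LinearCombinations.module_hom_def)

lemma lie_hom_zero:
  fixes K (structure)
  assumes "\<phi> \<in> lie_hom K L M" "lie_algebra K L" "lie_algebra K M"
  shows "\<phi> \<zero>\<^bsub>L\<^esub> = \<zero>\<^bsub>M\<^esub>"
proof -
  interpret L: lie_algebra K L by fact
  interpret M: lie_algebra K M by fact
  interpret mod_hom K L M \<phi>
    using assms(1) by unfold_locales (simp add: lie_hom_def)
  show ?thesis by (rule f0_is_0)
qed

lemma presented_hom_unique:
  fixes M :: "('a::field, 'b, 'm) lie_algebra_scheme"
  assumes M: "lie_algebra (class_ring :: 'a ring) M"
    and \<phi>: "\<phi> \<in> lie_hom class_ring (presented_lie_algebra I R) M"
    and \<psi>: "\<psi> \<in> lie_hom class_ring (presented_lie_algebra I R) M"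
    and eq: "\<And>i. i \<in> I \<Longrightarrow> \<phi> (presented_gen I R i) = \<psi> (presented_gen I R i)"
    and x: "x \<in> carrier (presented_lie_algebra I R)"
  shows "\<phi> x = \<psi> x"
proof -
  note zero = lie_hom_zero[OF _ presented_lie_algebra_is_lie_algebra M,
      unfolded presented_simps]
  have "\<phi> (lie_cong I R `` {t}) = \<psi> (lie_cong I R `` {t})" if "t \<in> lie_terms I" for t
    using that
  proof induction
    case (term_add s t)
    then show ?case
      using lie_homD(2)[OF \<phi>, of "lie_cong I R `` {s}" "lie_cong I R `` {t}"]
        lie_homD(2)[OF \<psi>, of "lie_cong I R `` {s}" "lie_cong I R `` {t}"]
      by (simp add: presented_add lie_class_closed)
  next
    case (term_smult t c)
    then show ?case
      using lie_homD(3)[OF \<phi>, of c "lie_cong I R `` {t}"]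
        lie_homD(3)[OF \<psi>, of c "lie_cong I R `` {t}"]
      by (simp add: presented_smult lie_class_closed)
  next
    case (term_bracket s t)
    then show ?case
      using lie_homD(4)[OF \<phi>, of "lie_cong I R `` {s}" "lie_cong I R `` {t}"]
        lie_homD(4)[OF \<psi>, of "lie_cong I R `` {s}" "lie_cong I R `` {t}"]
      by (simp add: presented_bracket lie_class_closed)
  qed (use eq zero[OF \<phi>] zero[OF \<psi>] in \<open>auto simp: presented_gen_def\<close>)
  then show ?thesis using x by (auto elim: presented_carrierE)
qed


text \<open>A bracket of two terms acts as the commutator of their actions, so stability under the
  generators passes to all terms. The induction carries membership and stability together, because
  membership of a bracket comes from stability under its left factor.\<close>

lemma presented_subset_submodule:
  assumes N: "submodule (class_ring :: 'a::field ring) N (presented_lie_algebra I R)"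
    and gen: "\<And>i. i \<in> I \<Longrightarrow> presented_gen I R i \<in> N"
    and ad: "\<And>i y. i \<in> I \<Longrightarrow> y \<in> N \<Longrightarrow>
      lie_bracket (presented_lie_algebra I R) (presented_gen I R i) y \<in> N"
  shows "carrier (presented_lie_algebra I R) \<subseteq> N"
proof -
  let ?L = "presented_lie_algebra I R" and ?C = "\<lambda>t. lie_cong I R `` {t}"
  interpret L: lie_algebra "class_ring :: 'a ring" ?L
    by (rule presented_lie_algebra_is_lie_algebra)
  interpret N: submodule "class_ring :: 'a ring" N ?L by (rule N)
  have closed: "y \<in> carrier ?L" if "y \<in> N" for y using that N.subset by blast
  have "?C t \<in> N \<and> (\<forall>y \<in> N. lie_bracket ?L (?C t) y \<in> N)" if "t \<in> lie_terms I" for t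
    using that
  proof induction
    case (term_gen i)
    then show ?case using gen ad by (simp add: presented_gen_def)
  next
    case term_zero
    then show ?case
      using N.zero_closed L.bracket_zero_left closed by (simp add: presented_simps)
  next
    case (term_add s t)
    then show ?case
      using N.m_closed[of "?C s" "?C t"] L.bracket_add_left[of "?C s" "?C t"] closed
      by (simp add: presented_add)
  next
    case (term_smult t c)
    then show ?case
      using N.smult_closed[of c "?C t"] L.bracket_smult_left[of c "?C t"] closed
      by (simp add: presented_smult)
  next
    case (term_bracket s t)
    have "lie_bracket ?L (lie_bracket ?L (?C s) (?C t)) y \<in> N" if y: "y \<in> N" for y
    proof -
      define A B D where "A = lie_bracket ?L (?C s) (lie_bracket ?L (?C t) y)"
        and "B = lie_bracket ?L (?C t) (lie_bracket ?L (?C s) y)"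
        and "D = lie_bracket ?L (lie_bracket ?L (?C s) (?C t)) y"
      have AB: "A \<in> N" "B \<in> N" using term_bracket y by (simp_all add: A_def B_def)
      have D: "D \<in> carrier ?L"
        using term_bracket closed y by (simp add: D_def L.bracket_closed)
      have "A = D \<oplus>\<^bsub>?L\<^esub> B"
        unfolding A_def B_def D_def using term_bracket closed y by (intro L.bracket_leibniz) auto
      then have "D = A \<oplus>\<^bsub>?L\<^esub> \<ominus>\<^bsub>?L\<^esub> B"
        using D AB closed by (simp add: L.M.a_assoc L.M.r_neg)
      then show ?thesis
        using AB L.submodule_neg[OF N] N.m_closed by (simp add: D_def)
    qed
    moreover have "lie_bracket ?L (?C s) (?C t) \<in> N" using term_bracket by simp
    ultimately show ?case using term_bracket by (simp add: presented_bracket)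
  qed
  then show ?thesis by (auto elim: presented_carrierE)
qed

section \<open>A spanning set for deformed Serre relations\<close>

text \<open>This is \<open>u\<^sub>i\<^sub>,\<^sub>d\<close>: the index \<open>d\<close> counts
  brackets, so \<open>d + 1\<close> generators occur.\<close>

primrec lie_chain :: "('a, 'b, 'm) lie_algebra_scheme \<Rightarrow> (nat \<Rightarrow> 'b) \<Rightarrow> nat \<Rightarrow> nat \<Rightarrow> 'b" where
  "lie_chain L u 0 i = u i"
| "lie_chain L u (Suc d) i = lie_bracket L (u i) (lie_chain L u d (Suc i))"

text \<open>Only the relations are assumed, not that the \<open>u i\<close> generate
  \<open>L\<close>. Characteristic zero permits the division by 2 in
  \<open>bracket_chain_second\<close>.\<close>

locale serre_deformation = lie_algebra "class_ring :: 'k ring" L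
  for L :: "('k::field_char_0, 'b, 'm) lie_algebra_scheme" (structure) +
  fixes N :: nat and u :: "nat \<Rightarrow> 'b" and b :: "nat \<Rightarrow> 'k"
  assumes u_closed: "i \<in> {1..N} \<Longrightarrow> u i \<in> carrier L"
    and u_commute: "\<lbrakk>i \<in> {1..N}; j \<in> {1..N}; \<bar>int i - int j\<bar> > 1\<rbrakk> \<Longrightarrow>
      lie_bracket L (u i) (u j) = \<zero>\<^bsub>L\<^esub>"
    and u_serre: "\<lbrakk>i \<in> {1..N}; j \<in> {1..N}; \<bar>int i - int j\<bar> = 1\<rbrakk> \<Longrightarrow>
      lie_bracket L (u i) (lie_bracket L (u i) (u j)) = (- 2 * b (min i j)) \<odot>\<^bsub>L\<^esub> u i"
begin

abbreviation br where "br \<equiv> lie_bracket L"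
abbreviation chain where "chain \<equiv> lie_chain L u"

text \<open>The bound on the starting index filters the chains, so that
  \<open>bracket_chain_later\<close> can treat the tail of a chain first and prepend its first
  generator afterwards.\<close>

definition chains_from :: "nat \<Rightarrow> 'b set" where
  "chains_from i = {chain d p | d p. i \<le> p \<and> p + d \<le> N}"

lemma chain_closed: "1 \<le> i \<Longrightarrow> i + d \<le> N \<Longrightarrow> chain d i \<in> carrier L"
  by (induction d arbitrary: i) (auto simp: u_closed bracket_closed)

lemma chains_from_closed: "1 \<le> i \<Longrightarrow> chains_from i \<subseteq> carrier L"
  by (auto simp: chains_from_def intro!: chain_closed)

lemma submodule_chains_from: "1 \<le> i \<Longrightarrow> submodule class_ring (span (chains_from i)) L"
  by (intro span_is_submodule chains_from_closed)

lemma chain_in_span: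
  "1 \<le> i \<Longrightarrow> i \<le> p \<Longrightarrow> p + d \<le> N \<Longrightarrow> chain d p \<in> span (chains_from i)"
  using in_own_span[OF chains_from_closed, of i] by (auto simp: chains_from_def)

lemma span_chains_from_antimono: "i \<le> j \<Longrightarrow> span (chains_from j) \<subseteq> span (chains_from i)"
  by (intro span_is_monotone) (unfold chains_from_def, use order.trans in blast)

section \<open>Brackets of a generator with a chain, by relative position\<close>

lemma bracket_chain_apart:
  assumes "1 \<le> l" "l + 1 < i" "i + d \<le> N"
  shows "br (u l) (chain d i) = \<zero>\<^bsub>L\<^esub>"
  using assms
proof (induction d arbitrary: i)
  case 0
  then show ?case by (simp add: u_commute)
next
  case (Suc d)
  have c: "u l \<in> carrier L" "u i \<in> carrier L" "chain d (Suc i) \<in> carrier L"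
    using Suc.prems by (auto intro: u_closed chain_closed)
  have "br (u l) (u i) = \<zero>\<^bsub>L\<^esub>" "br (u l) (chain d (Suc i)) = \<zero>\<^bsub>L\<^esub>"
    using Suc by (auto simp: u_commute)
  then show ?case
    using c by (simp add: bracket_leibniz[of "u l" "u i"] bracket_zero_left bracket_zero_right)
qed

text \<open>For \<open>d = 1\<close> this is the deformed Serre relation. In longer chains
  \<open>u i\<close> commutes with the tail \<open>y\<close> after the second factor
  \<open>x\<close>, so both brackets act on \<open>x\<close> alone and produce a multiple of
  \<open>br (u i) y\<close>, which is zero.\<close>

lemma bracket_chain_first:
  assumes "1 \<le> i" "i + d \<le> N"
  shows "\<exists>c. br (u i) (chain d i) = c \<odot>\<^bsub>L\<^esub> u i"
proof -
  have ui: "u i \<in> carrier L" using assms by (auto intro: u_closed)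
  have zero: "\<exists>c. \<zero>\<^bsub>L\<^esub> = c \<odot>\<^bsub>L\<^esub> u i"
    using smult_l_null[OF ui] by (intro exI[of _ 0]) simp
  consider "d = 0" | "d = 1" | e where "d = Suc (Suc e)"
    by (metis One_nat_def not0_implies_Suc)
  then show ?thesis
  proof cases
    case 1
    then show ?thesis using zero ui by (simp add: bracket_self)
  next
    case 2
    then show ?thesis using u_serre[of i "Suc i"] assms by auto
  next
    case 3
    define x y where "x = u (Suc i)" and "y = chain e (Suc (Suc i))"
    have c: "x \<in> carrier L" "y \<in> carrier L"
      using assms 3 by (auto simp: x_def y_def intro: u_closed chain_closed)
    have uy: "br (u i) y = \<zero>\<^bsub>L\<^esub>"
      using assms 3 by (auto simp: y_def intro: bracket_chain_apart)
    have "br (u i) (br x y) = br (br (u i) x) y"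
      using ui c uy by (simp add: bracket_leibniz[of "u i" x y] bracket_zero_right bracket_closed)
    then have "br (u i) (br (u i) (br x y)) = br (br (u i) (br (u i) x)) y"
      using ui c uy
      by (simp add: bracket_leibniz[of "u i" "br (u i) x" y] bracket_zero_right bracket_closed)
    also have "\<dots> = \<zero>\<^bsub>L\<^esub>"
      using u_serre[of i "Suc i"] assms 3 ui c uy
      by (simp add: x_def bracket_smult_left)
    finally show ?thesis using zero by (simp add: 3 x_def y_def)
  qed
qed

text \<open>This is the one case where moving the generator inwards does not suffice. For
  \<open>d = 0\<close> the Serre relation applies with the roles exchanged. For longer chains two
  expansions are added; the remaining terms are handled by that relation and by
  \<open>bracket_chain_first\<close>.\<close>

lemma bracket_chain_second:
  assumes "1 \<le> i" "i + Suc d \<le> N"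
  shows "br (u (Suc i)) (chain (Suc d) i) \<in> span (chains_from i)"
proof -
  interpret S: submodule class_ring "span (chains_from i)" L
    using assms(1) by (rule submodule_chains_from)
  define a x where "a = u i" and "x = u (Suc i)"
  have c: "a \<in> carrier L" "x \<in> carrier L"
    using assms by (auto simp: a_def x_def intro: u_closed)
  have xS: "x \<in> span (chains_from i)"
    using chain_in_span[of i "Suc i" 0] assms by (simp add: x_def)
  have axS: "br a x \<in> span (chains_from i)"
    using chain_in_span[of i i 1] assms by (simp add: a_def x_def)
  have "br x (br x a) = (- 2 * b i) \<odot>\<^bsub>L\<^esub> x"
    using u_serre[of "Suc i" i] assms by (simp add: a_def x_def min_def)
  then have xax: "br x (br a x) = \<ominus>\<^bsub>L\<^esub> ((- 2 * b i) \<odot>\<^bsub>L\<^esub> x)"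
    using c bracket_swap[of a x] by (simp add: bracket_neg_right bracket_closed)
  show ?thesis
  proof (cases d)
    case 0
    have "br x (br a x) \<in> span (chains_from i)"
      unfolding xax using xS by (intro submodule_neg[OF S.submodule_axioms] S.smult_closed) auto
    then show ?thesis by (simp add: 0 a_def x_def)
  next
    case (Suc e)
    define y where "y = chain e (Suc (Suc i))"
    have y: "y \<in> carrier L" using assms Suc by (auto simp: y_def intro: chain_closed)
    have ay: "br a y = \<zero>\<^bsub>L\<^esub>"
      using assms Suc by (auto simp: a_def y_def intro: bracket_chain_apart)
    have xyS: "br x y \<in> span (chains_from i)"
      using chain_in_span[of i "Suc i" "Suc e"] assms Suc by (simp add: x_def y_def)
    \<comment> \<open>Expanding \<open>T\<close> in two ways by the Jacobi identity gives \<open>T = Q - P\<close> and \<open>T = R + P\<close>, where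
      \<open>P\<close> is the only term that is not visibly in the span; hence \<open>2 T = R + Q\<close>.\<close>
    define T P Q R where "T = br x (br a (br x y))" and "P = br (br a x) (br x y)"
      and "Q = br a (br x (br x y))" and "R = br (br x (br a x)) y"
    have TPQR: "T \<in> carrier L" "P \<in> carrier L" "Q \<in> carrier L" "R \<in> carrier L"
      using c y by (auto simp: T_def P_def Q_def R_def bracket_closed)
    have "br (br x a) (br x y) = \<ominus>\<^bsub>L\<^esub> P"
      using c y bracket_swap[of x a]
        bracket_swap[of "br a x" "br x y"] bracket_swap[of "br x a" "br x y"]
      by (simp add: P_def bracket_closed bracket_neg_right)
    then have T1: "T = \<ominus>\<^bsub>L\<^esub> P \<oplus>\<^bsub>L\<^esub> Q"
      using c y by (simp add: T_def Q_def bracket_leibniz[of x a "br x y"] bracket_closed)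
    have "br a (br x y) = br (br a x) y"
      using c y ay by (simp add: bracket_leibniz[of a x y] bracket_zero_right bracket_closed)
    then have T2: "T = R \<oplus>\<^bsub>L\<^esub> P"
      using c y by (simp add: T_def R_def P_def bracket_leibniz[of x "br a x" y] bracket_closed)
    have "2 \<odot>\<^bsub>L\<^esub> T = T \<oplus>\<^bsub>L\<^esub> T"
      using smult_l_distr[of 1 1 T] smult_one[of T] TPQR by simp
    also have "\<dots> = (R \<oplus>\<^bsub>L\<^esub> P) \<oplus>\<^bsub>L\<^esub> (\<ominus>\<^bsub>L\<^esub> P \<oplus>\<^bsub>L\<^esub> Q)"
      using T1 T2 by simp
    also have "\<dots> = R \<oplus>\<^bsub>L\<^esub> Q"
      using TPQR by (simp add: M.a_assoc M.r_neg2)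
    finally have 2: "2 \<odot>\<^bsub>L\<^esub> T = R \<oplus>\<^bsub>L\<^esub> Q" .
    have "R = \<ominus>\<^bsub>L\<^esub> ((- 2 * b i) \<odot>\<^bsub>L\<^esub> br x y)"
      unfolding R_def xax using c y bracket_swap[of "\<ominus>\<^bsub>L\<^esub> ((- 2 * b i) \<odot>\<^bsub>L\<^esub> x)" y]
        bracket_swap[of "(- 2 * b i) \<odot>\<^bsub>L\<^esub> x" y]
      by (simp add: bracket_neg_right bracket_smult_left bracket_closed)
    then have RS: "R \<in> span (chains_from i)"
      using xyS by (auto intro!: submodule_neg[OF S.submodule_axioms])
    obtain e' where "br x (br x y) = e' \<odot>\<^bsub>L\<^esub> x"
      using bracket_chain_first[of "Suc i" "Suc e"] assms Suc by (auto simp: x_def y_def)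
    then have "Q = e' \<odot>\<^bsub>L\<^esub> br a x"
      using c by (simp add: Q_def bracket_smult_right)
    then have QS: "Q \<in> span (chains_from i)"
      using axS by auto
    have "(1 / 2) \<odot>\<^bsub>L\<^esub> (2 \<odot>\<^bsub>L\<^esub> T) = T"
      using smult_assoc1[of "1 / 2" 2 T] smult_one[of T] TPQR by simp
    then have "T = (1 / 2) \<odot>\<^bsub>L\<^esub> (R \<oplus>\<^bsub>L\<^esub> Q)" using 2 by simp
    also have "\<dots> \<in> span (chains_from i)"
      using RS QS by auto
    finally show ?thesis by (simp add: Suc T_def a_def x_def y_def)
  qed
qed

text \<open>Bracketing with \<open>u i\<close> lengthens the chains that start at
  \<open>Suc i\<close> and annihilates those that start later.\<close>

lemma bracket_span_next:
  assumes "1 \<le> i" "i < N" "z \<in> span (chains_from (Suc i))"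
  shows "br (u i) z \<in> span (chains_from i)"
proof (rule bracket_span[OF submodule_chains_from _ _ _ assms(3)])
  fix y assume "y \<in> chains_from (Suc i)"
  then obtain d p where y: "y = chain d p" "Suc i \<le> p" "p + d \<le> N"
    by (auto simp: chains_from_def)
  interpret S: submodule class_ring "span (chains_from i)" L
    using assms(1) by (rule submodule_chains_from)
  show "br (u i) y \<in> span (chains_from i)"
  proof (cases "p = Suc i")
    case True
    then show ?thesis using chain_in_span[of i i "Suc d"] assms y by simp
  next
    case False
    then have "br (u i) y = \<zero>\<^bsub>L\<^esub>" using y assms by (auto intro: bracket_chain_apart)
    then show ?thesis by simp
  qed
qed (use assms in \<open>auto intro!: u_closed chains_from_closed del: subsetI\<close>)

text \<open>If \<open>l\<close> exceeds \<open>Suc i\<close>, then \<open>u l\<close> commutes with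
  \<open>u i\<close> and acts on the tail only. The induction hypothesis keeps the result among
  chains from \<open>Suc i\<close>, and \<open>bracket_span_next\<close> restores the first
  factor.\<close>

lemma bracket_chain_later:
  assumes "1 \<le> i" "i + d \<le> N" "i < l" "l \<le> N"
  shows "br (u l) (chain d i) \<in> span (chains_from i)"
  using assms
proof (induction d arbitrary: i)
  case 0
  interpret S: submodule class_ring "span (chains_from i)" L
    using 0(1) by (rule submodule_chains_from)
  show ?case
  proof (cases "l = Suc i")
    case True
    have "br (u l) (u i) = \<ominus>\<^bsub>L\<^esub> br (u i) (u l)"
      using 0 by (intro bracket_swap u_closed) auto
    moreover have "br (u i) (u l) \<in> span (chains_from i)"
      using chain_in_span[of i i 1] 0 True by simp
    ultimately show ?thesis using submodule_neg[OF S.submodule_axioms] by simp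
  next
    case False
    then show ?thesis using 0 by (simp add: u_commute)
  qed
next
  case (Suc d)
  show ?case
  proof (cases "l = Suc i")
    case True
    then show ?thesis using bracket_chain_second Suc.prems by blast
  next
    case False
    have c: "u l \<in> carrier L" "u i \<in> carrier L" "chain d (Suc i) \<in> carrier L"
      using Suc.prems by (auto intro: u_closed chain_closed)
    have "br (u l) (u i) = \<zero>\<^bsub>L\<^esub>" using Suc.prems False by (simp add: u_commute)
    then have "br (u l) (chain (Suc d) i) = br (u i) (br (u l) (chain d (Suc i)))"
      using c by (simp add: bracket_leibniz[of "u l" "u i"] bracket_zero_left bracket_closed)
    moreover have "br (u l) (chain d (Suc i)) \<in> span (chains_from (Suc i))"
      using Suc.prems False by (intro Suc.IH) auto
    ultimately show ?thesis using bracket_span_next[of i] Suc.prems by simp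
  qed
qed

lemma bracket_span_chains:
  assumes "l \<in> {1..N}" "z \<in> span (chains_from 1)"
  shows "br (u l) z \<in> span (chains_from 1)"
proof (rule bracket_span[OF submodule_chains_from _ _ _ assms(2)])
  fix y assume "y \<in> chains_from 1"
  then obtain d p where y: "y = chain d p" "1 \<le> p" "p + d \<le> N"
    by (auto simp: chains_from_def)
  interpret S: submodule class_ring "span (chains_from 1)" L
    by (rule submodule_chains_from) simp
  \<comment> \<open>In this order, \<open>u l\<close> annihilates the chain, lengthens it, or sends
    it to a multiple of \<open>u l\<close>; the last case is
    \<open>bracket_chain_later\<close>.\<close>
  consider "l + 1 < p" | "p = Suc l" | "l = p" | "p < l" by linarith
  then show "br (u l) y \<in> span (chains_from 1)"
  proof cases
    case 1
    then have "br (u l) y = \<zero>\<^bsub>L\<^esub>" using y assms by (auto intro: bracket_chain_apart)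
    then show ?thesis using S.zero_closed by simp
  next
    case 2
    then show ?thesis using chain_in_span[of 1 l "Suc d"] assms y by simp
  next
    case 3
    then obtain c where "br (u l) y = c \<odot>\<^bsub>L\<^esub> u l" using bracket_chain_first y by blast
    moreover have "u l \<in> span (chains_from 1)"
      using chain_in_span[of 1 l 0] assms by simp
    ultimately show ?thesis using S.smult_closed[of c "u l"] by simp
  next
    case 4
    then have "br (u l) y \<in> span (chains_from p)"
      using y assms by (auto intro: bracket_chain_later)
    then show ?thesis using span_chains_from_antimono y by blast
  qed
qed (use assms in \<open>auto intro!: u_closed chains_from_closed del: subsetI\<close>)

end

section \<open>Triangular systems of functionals\<close>

lemma (in Module.module) span_insertE:
  assumes v: "v \<in> carrier M" and A: "A \<subseteq> carrier M" and x: "x \<in> span (insert v A)"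
  obtains c y where "c \<in> carrier R" "y \<in> span A" "x = c \<odot>\<^bsub>M\<^esub> v \<oplus>\<^bsub>M\<^esub> y"
proof -
  let ?N = "{c \<odot>\<^bsub>M\<^esub> v \<oplus>\<^bsub>M\<^esub> y | c y. c \<in> carrier R \<and> y \<in> span A}"
  interpret S: submodule R "span A" M using A by (rule span_is_submodule)
  have S: "y \<in> carrier M" if "y \<in> span A" for y using that S.subset by blast
  have "submodule R ?N M"
  proof (intro submodule.intro module_axioms)
    show "?N \<subseteq> carrier M" using v S by auto
    show "\<zero>\<^bsub>M\<^esub> \<in> ?N"
      using v by (intro CollectI exI[of _ "\<zero>\<^bsub>R\<^esub>"] exI[of _ "\<zero>\<^bsub>M\<^esub>"]) auto
  next
    fix x y assume "x \<in> ?N" "y \<in> ?N"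
    then obtain c d s t where *: "c \<in> carrier R" "d \<in> carrier R" "s \<in> span A" "t \<in> span A"
      and xy: "x = c \<odot>\<^bsub>M\<^esub> v \<oplus>\<^bsub>M\<^esub> s" "y = d \<odot>\<^bsub>M\<^esub> v \<oplus>\<^bsub>M\<^esub> t" by auto
    have "x \<oplus>\<^bsub>M\<^esub> y = (c \<oplus>\<^bsub>R\<^esub> d) \<odot>\<^bsub>M\<^esub> v \<oplus>\<^bsub>M\<^esub> (s \<oplus>\<^bsub>M\<^esub> t)"
      unfolding xy using * v S by (simp add: smult_l_distr M.a_ac)
    then show "x \<oplus>\<^bsub>M\<^esub> y \<in> ?N" using * by blast
  next
    fix c x assume c: "c \<in> carrier R" and "x \<in> ?N"
    then obtain d s where *: "d \<in> carrier R" "s \<in> span A" and x: "x = d \<odot>\<^bsub>M\<^esub> v \<oplus>\<^bsub>M\<^esub> s"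
      by auto
    have "c \<odot>\<^bsub>M\<^esub> x = (c \<otimes>\<^bsub>R\<^esub> d) \<odot>\<^bsub>M\<^esub> v \<oplus>\<^bsub>M\<^esub> c \<odot>\<^bsub>M\<^esub> s"
      unfolding x using c * v S by (simp add: smult_r_distr smult_assoc1)
    then show "c \<odot>\<^bsub>M\<^esub> x \<in> ?N" using c * by blast
  qed
  moreover have "insert v A \<subseteq> ?N"
  proof
    fix y assume "y \<in> insert v A"
    then show "y \<in> ?N"
    proof
      assume "y = v"
      then show ?thesis
        using v by (intro CollectI exI[of _ "\<one>\<^bsub>R\<^esub>"] exI[of _ "\<zero>\<^bsub>M\<^esub>"]) auto
    next
      assume "y \<in> A"
      then show ?thesis
        using v A in_own_span[OF A]
        by (intro CollectI exI[of _ "\<zero>\<^bsub>R\<^esub>"] exI[of _ y]) auto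
    qed
  qed
  ultimately have "span (insert v A) \<subseteq> ?N" by (intro span_is_subset)
  then show thesis using x that by auto
qed

text \<open>Vectors are added in order of nondecreasing rank. The functional of the newest vector
  vanishes on all earlier ones, so it forces the newest coefficient to be zero, and the rest lies in
  the smaller span. With functionals pulled back along a linear map, this gives a trivial kernel
  without knowing beforehand that the \<open>v p\<close> are independent.\<close>

lemma triangular_functionals_separate_span:
  fixes V :: "('k::field, 'b, 'm) module_scheme" and h :: "'i \<Rightarrow> 'b \<Rightarrow> 'k"
    and rank :: "'i \<Rightarrow> nat"
  assumes V: "Module.module (class_ring :: 'k ring) V"
    and "finite P"
    and v: "\<And>p. p \<in> P \<Longrightarrow> v p \<in> carrier V"
    and h_add: "\<And>p x y. \<lbrakk>p \<in> P; x \<in> carrier V; y \<in> carrier V\<rbrakk> \<Longrightarrow>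
      h p (x \<oplus>\<^bsub>V\<^esub> y) = h p x + h p y"
    and h_smult: "\<And>p c x. \<lbrakk>p \<in> P; x \<in> carrier V\<rbrakk> \<Longrightarrow> h p (c \<odot>\<^bsub>V\<^esub> x) = c * h p x"
    and diag: "\<And>p. p \<in> P \<Longrightarrow> h p (v p) \<noteq> 0"
    and tri: "\<And>p q. \<lbrakk>p \<in> P; q \<in> P; q \<noteq> p; rank q \<le> rank p\<rbrakk> \<Longrightarrow> h p (v q) = 0"
    and "x \<in> LinearCombinations.module.span class_ring V (v ` P)" and "\<And>p. p \<in> P \<Longrightarrow> h p x = 0"
  shows "x = \<zero>\<^bsub>V\<^esub>"
proof -
  interpret V: Module.module "class_ring :: 'k ring" V by (rule V)
  have "\<forall>x \<in> V.span (v ` Q). (\<forall>p \<in> Q. h p x = 0) \<longrightarrow> x = \<zero>\<^bsub>V\<^esub>"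
    if "finite Q" "Q \<subseteq> P" for Q
    using that
  proof (induction rule: finite_ranking_induct[where f = rank])
    case empty
    then show ?case by (simp add: V.span_def V.lincomb_def)
  next
    case (insert p Q)
    show ?case
    proof (cases "p \<in> Q")
      case True
      then show ?thesis using insert by (simp add: insert_absorb)
    next
      case False
      show ?thesis
      proof (intro ballI impI)
        fix x assume "x \<in> V.span (v ` insert p Q)" and hx: "\<forall>p \<in> insert p Q. h p x = 0"
        have p: "p \<in> P" "v p \<in> carrier V" and Q: "v ` Q \<subseteq> carrier V"
          using insert.prems v by auto
        have "x \<in> V.span (insert (v p) (v ` Q))"
          using \<open>x \<in> V.span (v ` insert p Q)\<close> by simp
        then obtain c y where y: "y \<in> V.span (v ` Q)" and x: "x = c \<odot>\<^bsub>V\<^esub> v p \<oplus>\<^bsub>V\<^esub> y"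
          by (rule V.span_insertE[OF p(2) Q])
        have yV: "y \<in> carrier V" using y Q V.span_is_subset2 by blast
        have "h p (\<zero>\<^bsub>V\<^esub>) = 0"
          using h_smult[OF p(1), of "\<zero>\<^bsub>V\<^esub>" 0] V.smult_l_null[of "\<zero>\<^bsub>V\<^esub>"] by simp
        then have "submodule class_ring {z \<in> carrier V. h p z = 0} V"
          by (intro submodule.intro V) (auto simp: h_add h_smult p)
        moreover have "v ` Q \<subseteq> {z \<in> carrier V. h p z = 0}"
        proof
          fix z assume "z \<in> v ` Q"
          then obtain q where "q \<in> Q" "z = v q" by blast
          moreover have "h p (v q) = 0" if "q \<in> Q" for q
            using that insert.hyps insert.prems False by (intro tri) auto
          ultimately show "z \<in> {z \<in> carrier V. h p z = 0}" using Q by blast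
        qed
        ultimately have "V.span (v ` Q) \<subseteq> {z \<in> carrier V. h p z = 0}"
          by (intro V.span_is_subset)
        then have "h p y = 0" using y by blast
        then have "c * h p (v p) = 0"
          using hx p yV by (simp add: x h_add h_smult)
        then have "x = y"
          using diag[OF p(1)] V.smult_l_null[of "v p"] p yV by (simp add: x)
        then show "x = \<zero>\<^bsub>V\<^esub>" using insert.IH insert.prems hx y by simp
      qed
    qed
  qed
  from this[OF \<open>finite P\<close> order.refl] show ?thesis using assms(8,9) by blast
qed

section \<open>The images of the generators\<close>

text \<open>Vectors are functions whose indices start from 1, as those of matrix units do; the functions
  \<open>gen_col\<close> and \<open>gen_row\<close> below are \<open>v\<^sub>i\<close> and \<open>w\<^sub>i\<close>.\<close>

definition outer :: "nat \<Rightarrow> (nat \<Rightarrow> 'a) \<Rightarrow> (nat \<Rightarrow> 'a) \<Rightarrow> 'a::comm_ring_1 mat" where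
  "outer n v w = mat n n (\<lambda>(r, c). v (Suc r) * w (Suc c))"

definition pairing :: "nat \<Rightarrow> (nat \<Rightarrow> 'a) \<Rightarrow> (nat \<Rightarrow> 'a) \<Rightarrow> 'a::comm_ring_1" where
  "pairing n w v = (\<Sum>s\<in>{1..n}. w s * v s)"

lemma outer_carrier [simp]: "outer n v w \<in> carrier_mat n n"
  by (simp add: outer_def)

lemma pairing_shift: "pairing n w v = (\<Sum>s<n. w (Suc s) * v (Suc s))"
  unfolding pairing_def by (rule sum.reindex_bij_witness[of _ Suc "\<lambda>s. s - 1"]) auto

lemma outer_mult: "outer n v w * outer n v' w' = pairing n w v' \<cdot>\<^sub>m outer n v w'"
  by (rule eq_matI)
    (auto simp: outer_def pairing_shift scalar_prod_def lessThan_atLeast0 sum_distrib_left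
      sum_distrib_right mult_ac intro!: sum.cong)

lemma trace_outer: "(\<Sum>i<n. outer n v w $$ (i, i)) = pairing n w v"
  by (simp add: outer_def pairing_shift mult.commute)

text \<open>The hypothesis gives \<open>A * A = 0\<close>, so the double commutator is
  \<open>- 2\<close> times \<open>A * B * A\<close>, and this triple product is \<open>A\<close>
  scaled by the two mixed pairings.\<close>

lemma double_commutator_outer:
  fixes v w v' w' :: "nat \<Rightarrow> 'a::comm_ring_1"
  assumes "pairing n w v = 0"
  defines "A \<equiv> outer n v w" and "B \<equiv> outer n v' w'"
  shows "A * (A * B - B * A) - (A * B - B * A) * A =
    (- 2 * (pairing n w v' * pairing n w' v)) \<cdot>\<^sub>m A"
proof -
  have AB: "A * B = pairing n w v' \<cdot>\<^sub>m outer n v w'" "B * A = pairing n w' v \<cdot>\<^sub>m outer n v' w"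
    by (simp_all add: A_def B_def outer_mult)
  note mult = mult_minus_distrib_mat[of _ n n _ n] minus_mult_distrib_mat[of _ n n _ _ n]
    mult_smult_distrib[of _ n n _ n] mult_smult_assoc_mat[of _ n n _ n]
  have "A * (A * B - B * A) = 0 \<cdot>\<^sub>m outer n v w' -
      pairing n w' v \<cdot>\<^sub>m (pairing n w v' \<cdot>\<^sub>m outer n v w)"
    unfolding AB unfolding A_def by (simp add: mult outer_mult assms(1)) (auto intro!: eq_matI simp: outer_def)
  moreover have "(A * B - B * A) * A = pairing n w v' \<cdot>\<^sub>m (pairing n w' v \<cdot>\<^sub>m outer n v w) -
      0 \<cdot>\<^sub>m outer n v' w"
    unfolding AB unfolding A_def by (simp add: mult outer_mult assms(1)) (auto intro!: eq_matI simp: outer_def)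
  ultimately show ?thesis
    unfolding A_def by (intro eq_matI) (auto simp: outer_def algebra_simps)
qed

definition gen_col :: "nat \<Rightarrow> (nat \<Rightarrow> complex) \<Rightarrow> nat \<Rightarrow> nat \<Rightarrow> complex" where
  "gen_col k b i r = (if r = i then 1 else if r = i + 2 \<and> k \<le> i then b i else 0)"

definition gen_row :: "nat \<Rightarrow> (nat \<Rightarrow> complex) \<Rightarrow> nat \<Rightarrow> nat \<Rightarrow> complex" where
  "gen_row k b i c = (if c = i + 1 then 1 else if c + 1 = i \<and> i \<le> k then b (i - 1) else 0)"

section \<open>Matrix units and the rank one form of the generator images\<close>

lemma mat_unit_mult:
  "mat_unit n i j * mat_unit n p q =
    (if j = p \<and> j \<in> {1..n} then mat_unit n i q else 0\<^sub>m n n)"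
proof (rule eq_matI)
  fix r c assume "r < dim_row (if j = p \<and> j \<in> {1..n} then mat_unit n i q else 0\<^sub>m n n)"
    "c < dim_col (if j = p \<and> j \<in> {1..n} then mat_unit n i q else 0\<^sub>m n n)"
  then have rc: "r < n" "c < n" by (auto simp: mat_unit_def split: if_splits)
  have "(mat_unit n i j * mat_unit n p q) $$ (r, c) =
      (\<Sum>s<n. (if Suc r = i \<and> Suc s = j then 1 else 0) * (if Suc s = p \<and> Suc c = q then 1 else 0))"
    using rc by (simp add: mat_unit_def scalar_prod_def lessThan_atLeast0)
  \<comment> \<open>At most one summand survives. The condition \<open>1 \<le> j\<close> guards
    against truncated subtraction at \<open>j = 0\<close>.\<close>
  also have "\<dots> = (\<Sum>s<n. if s = j - 1 then (if 1 \<le> j \<and> j = p \<and> Suc r = i \<and> Suc c = q then 1 else 0) else 0)"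
    by (intro sum.cong) auto
  also have "\<dots> = (if j = p \<and> j \<in> {1..n} then mat_unit n i q else 0\<^sub>m n n) $$ (r, c)"
    using rc by (auto simp: mat_unit_def)
  finally show "(mat_unit n i j * mat_unit n p q) $$ (r, c) =
      (if j = p \<and> j \<in> {1..n} then mat_unit n i q else 0\<^sub>m n n) $$ (r, c)" .
qed (auto simp: mat_unit_def)

lemma mat_unit_dim [simp]: "dim_row (mat_unit n i j) = n" "dim_col (mat_unit n i j) = n"
  by (simp_all add: mat_unit_def)

text \<open>The inner bracket is \<open>- E\<^sub>k\<^sub>+\<^sub>2\<^sub>,\<^sub>k\<close>, and the
  outer one reverses the sign again. For \<open>k = 1\<close> or \<open>k = n - 1\<close> both sides
  vanish, since an index leaves \<open>{1..n}\<close>.\<close>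

lemma chev_f_triple_bracket:
  assumes "k \<in> {1..n-1}"
  shows "lie_bracket (sl n) (chev_f n (k - 1)) (lie_bracket (sl n) (chev_f n k) (chev_f n (k + 1))) =
    mat_unit n (k + 2) (k - 1)"
proof -
  have "lie_bracket (sl n) (chev_f n k) (chev_f n (k + 1)) = - mat_unit n (k + 2) k"
    using assms by (auto simp: sl_def chev_f_def mat_unit_mult intro!: eq_matI)
  moreover have "chev_f n (k - 1) * - mat_unit n (k + 2) k = - (chev_f n (k - 1) * mat_unit n (k + 2) k)"
    "- mat_unit n (k + 2) k * chev_f n (k - 1) = - (mat_unit n (k + 2) k * chev_f n (k - 1))"
    by (simp_all add: chev_f_def)
  ultimately show ?thesis
    using assms by (auto simp: sl_def chev_f_def mat_unit_mult intro!: eq_matI)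
qed

text \<open>Below \<open>k\<close> the deformation sits in the row vector, above \<open>k\<close> in
  the column vector. At \<open>k\<close> it sits in both, and expanding the product yields the term
  \<open>b\<^sub>k\<^sub>-\<^sub>1 b\<^sub>k
  E\<^sub>k\<^sub>+\<^sub>2\<^sub>,\<^sub>k\<^sub>-\<^sub>1\<close>, which fixes the sign of the
  triple bracket.\<close>

lemma gen_image_outer:
  assumes "k \<in> {1..n-1}" "i \<in> {1..n-1}"
  shows "gen_image n k b i = outer n (gen_col k b i) (gen_row k b i)"
proof -
  note entries = chev_e_def chev_f_def mat_unit_def outer_def gen_col_def gen_row_def
  consider "i < k" | "k < i" | "i = k" by linarith
  then show ?thesis
  proof cases
    case 3
    show ?thesis
      unfolding gen_image_def Let_def chev_f_triple_bracket[OF assms(1)] 3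
      using assms by (intro eq_matI) (simp_all add: entries, arith)
  qed (use assms in \<open>auto simp: gen_image_def entries intro!: eq_matI\<close>)
qed

section \<open>Pairings of the row and column vectors, and the relations they imply\<close>

lemma pairing_gen_row:
  assumes "i \<in> {1..n-1}"
  shows "pairing n (gen_row k b i) g =
    g (i + 1) + (if 2 \<le> i \<and> i \<le> k then b (i - 1) * g (i - 1) else 0)"
proof -
  have "pairing n (gen_row k b i) g = (\<Sum>s\<in>{1..n}. (if s = i + 1 then g s else 0) +
      (if s = i - 1 then (if i \<le> k then b (i - 1) * g (i - 1) else 0) else 0))"
    unfolding pairing_def by (intro sum.cong) (auto simp: gen_row_def)
  then show ?thesis using assms by (auto simp: sum.distrib)
qed

lemma pairing_gen_col:
  assumes "i \<in> {1..n-1}"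
  shows "pairing n g (gen_col k b i) =
    g i + (if i + 2 \<le> n \<and> k \<le> i then g (i + 2) * b i else 0)"
proof -
  have "pairing n g (gen_col k b i) = (\<Sum>s\<in>{1..n}. (if s = i then g s else 0) +
      (if s = i + 2 then (if k \<le> i then g (i + 2) * b i else 0) else 0))"
    unfolding pairing_def by (intro sum.cong) (auto simp: gen_col_def)
  then show ?thesis using assms by (auto simp: sum.distrib)
qed

text \<open>The row vector lives on \<open>i - 1\<close> and \<open>i + 1\<close>, the column vector
  on \<open>j\<close> and \<open>j + 2\<close>. Under the hypothesis these can meet only for
  \<open>i = j + 3\<close>, where two nonzero entries would require \<open>i \<le> k\<close> and
  \<open>k \<le> j\<close>.\<close>

lemma pairing_gen_zero:
  assumes "i \<in> {1..n-1}" "i = j \<or> \<bar>int i - int j\<bar> > 1"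
  shows "pairing n (gen_row k b i) (gen_col k b j) = 0"
proof -
  have "i = j \<or> i + 1 < j \<or> j + 1 < i" using assms(2) by linarith
  then show ?thesis unfolding pairing_gen_row[OF assms(1)] gen_col_def by auto
qed

text \<open>For \<open>j = i + 1\<close> the first pairing is 1. In the second, \<open>b i\<close>
  comes from the row vector if \<open>i < k\<close> and from the column vector if
  \<open>k \<le> i\<close>, hence exactly once.\<close>

lemma pairing_gen_neighbours:
  assumes "i \<in> {1..n-1}" "j \<in> {1..n-1}" "\<bar>int i - int j\<bar> = 1"
  shows "pairing n (gen_row k b i) (gen_col k b j) * pairing n (gen_row k b j) (gen_col k b i) =
    b (min i j)"
proof -
  have "j = Suc i \<or> i = Suc j" using assms(3) by linarith
  then show ?thesis
    unfolding pairing_gen_row[OF assms(1)] pairing_gen_row[OF assms(2)] gen_col_def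
    using assms(1,2) by (elim disjE) auto
qed

lemma gen_image_closed:
  assumes "k \<in> {1..n-1}" "i \<in> {1..n-1}"
  shows "gen_image n k b i \<in> carrier (sl n)"
  using assms
  by (simp add: gen_image_outer sl_def trace_outer pairing_gen_zero)

lemma gen_image_commute:
  assumes "k \<in> {1..n-1}" "i \<in> {1..n-1}" "j \<in> {1..n-1}" "\<bar>int i - int j\<bar> > 1"
  shows "lie_bracket (sl n) (gen_image n k b i) (gen_image n k b j) = \<zero>\<^bsub>sl n\<^esub>"
proof -
  have "\<bar>int j - int i\<bar> > 1" using assms(4) by linarith
  then show ?thesis
    using assms pairing_gen_zero[of i n j k b] pairing_gen_zero[of j n i k b]
    by (simp add: gen_image_outer sl_def outer_mult) (auto simp: outer_def)
qed

lemma gen_image_serre: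
  assumes "k \<in> {1..n-1}" "i \<in> {1..n-1}" "j \<in> {1..n-1}" "\<bar>int i - int j\<bar> = 1"
  shows "lie_bracket (sl n) (gen_image n k b i)
      (lie_bracket (sl n) (gen_image n k b i) (gen_image n k b j)) =
    (- 2 * b (min i j)) \<odot>\<^bsub>sl n\<^esub> gen_image n k b i"
  using double_commutator_outer[of n "gen_row k b i" "gen_col k b i" "gen_col k b j" "gen_row k b j"]
    assms pairing_gen_zero[of i n i k b] pairing_gen_neighbours[of i n j k b]
  by (simp add: gen_image_outer sl_def)

section \<open>Leading diagonals of the chain images\<close>

lemma lie_chain_gen_image_closed:
  assumes "k \<in> {1..n-1}" "1 \<le> i" "i + d \<le> n - 1"
  shows "lie_chain (sl n) (gen_image n k b) d i \<in> carrier (sl n)"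
  using assms
proof (induction d arbitrary: i)
  case (Suc d)
  interpret lie_algebra "class_ring :: complex ring" "sl n" by (rule sl_is_lie_algebra)
  show ?case using Suc by (simp add: bracket_closed gen_image_closed)
qed (simp add: gen_image_closed)

lemma outer_mult_index:
  assumes "A \<in> carrier_mat n n" "r \<in> {1..n}" "c \<in> {1..n}"
  shows "(outer n v w * A) $$ (r - 1, c - 1) = v r * pairing n w (\<lambda>s. A $$ (s - 1, c - 1))"
    and "(A * outer n v w) $$ (r - 1, c - 1) = pairing n (\<lambda>s. A $$ (r - 1, s - 1)) v * w c"
  using assms
  by (auto simp: outer_def pairing_shift scalar_prod_def lessThan_atLeast0 sum_distrib_left
      sum_distrib_right mult_ac intro!: sum.cong)

text \<open>Multiplication by a generator image raises the diagonal by at most one, and only through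
  \<open>E\<^sub>i\<^sub>,\<^sub>i\<^sub>+\<^sub>1\<close>. On the leading diagonal only the product
  in the order \<open>U * A\<close> contributes.\<close>

lemma lie_chain_gen_image_top:
  assumes "k \<in> {1..n-1}" "1 \<le> i" "i + d \<le> n - 1"
    and "1 \<le> r" "r + d + 1 \<le> c" "c \<le> n"
  shows "lie_chain (sl n) (gen_image n k b) d i $$ (r - 1, c - 1) =
    (if r = i \<and> c = i + d + 1 then 1 else 0)"
  using assms(2-)
proof (induction d arbitrary: i r c)
  case 0
  then show ?case using assms(1) by (auto simp: gen_image_outer outer_def gen_col_def gen_row_def)
next
  case (Suc d)
  define A where "A = lie_chain (sl n) (gen_image n k b) d (Suc i)"
  define U where "U = outer n (gen_col k b i) (gen_row k b i)"
  have A: "A \<in> carrier_mat n n"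
    using lie_chain_gen_image_closed[of k n "Suc i" d b] assms(1) Suc.prems
    by (auto simp: A_def sl_def)
  have U: "U = gen_image n k b i" "U \<in> carrier_mat n n"
    using assms(1) Suc.prems by (auto simp: U_def gen_image_outer)
  \<comment> \<open>The indices here start from 0, so row \<open>i\<close> is the row
    \<open>Suc i\<close> at which the tail of the chain starts.\<close>
  have IH: "A $$ (s, t) = (if s = i \<and> t = i + d + 1 then 1 else 0)"
    if "s + d + 1 \<le> t" "t < n" for s t
    using Suc.IH[of "Suc i" "Suc s" "Suc t"] Suc.prems that by (auto simp: A_def)
  have "(U * A) $$ (r - 1, c - 1) = (if r = i \<and> c = i + Suc d + 1 then 1 else 0)"
    using Suc.prems unfolding U_def
    by (subst outer_mult_index[OF A])
      (auto simp: pairing_gen_row gen_col_def IH)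
  moreover have "(A * U) $$ (r - 1, c - 1) = 0"
    using Suc.prems unfolding U_def
    by (subst outer_mult_index[OF A])
      (auto simp: pairing_gen_col gen_row_def IH)
  moreover have "lie_chain (sl n) (gen_image n k b) (Suc d) i = U * A - A * U"
    by (simp add: U A_def sl_def)
  ultimately show ?case using A U(2) Suc.prems by auto
qed

section \<open>The embedding\<close>

lemma lie_hom_chain:
  assumes \<phi>: "\<phi> \<in> lie_hom K L M"
    and u: "\<And>i. i \<in> {1..N} \<Longrightarrow> \<phi> (u i) = g i"
    and closed: "\<And>d i. 1 \<le> i \<Longrightarrow> i + d \<le> N \<Longrightarrow> lie_chain L u d i \<in> carrier L"
    and "1 \<le> i" "i + d \<le> N"
  shows "\<phi> (lie_chain L u d i) = lie_chain M g d i"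
  using assms(4,5)
proof (induction d arbitrary: i)
  case (Suc d)
  have "\<phi> (lie_chain L u (Suc d) i) = lie_bracket M (\<phi> (u i)) (\<phi> (lie_chain L u d (Suc i)))"
    using lie_homD(4)[OF \<phi>, of "u i" "lie_chain L u d (Suc i)"]
      closed[of i 0] closed[of "Suc i" d] Suc.prems by simp
  then show ?case using Suc u[of i] by simp
qed (simp add: u)

lemma sl_b_serre_deformation:
  "serre_deformation (sl_b n b) (n - 1) (sl_b_gen n b) b"
proof (intro serre_deformation.intro serre_deformation_axioms.intro)
  show "lie_algebra class_ring (sl_b n b)"
    unfolding sl_b_def by (rule presented_lie_algebra_is_lie_algebra)
next
  fix i j assume ij: "i \<in> {1..n-1}" "j \<in> {1..n-1}" "\<bar>int i - int j\<bar> > 1"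
  then have gens: "LGen i \<in> lie_terms {1..n-1}" "LGen j \<in> lie_terms {1..n-1}"
    by (auto intro: lie_terms.term_gen)
  have "(LBracket (LGen i) (LGen j), LZero) \<in> lie_cong {1..n-1} (sl_b_relations n b)"
    using ij gens
    by (intro lie_cong.cong_relation) (auto simp: sl_b_relations_def intro: lie_terms.intros)
  from equiv_class_eq[OF equiv_lie_cong this]
  show "lie_bracket (sl_b n b) (sl_b_gen n b i) (sl_b_gen n b j) = \<zero>\<^bsub>sl_b n b\<^esub>"
    unfolding sl_b_def sl_b_gen_def presented_gen_def presented_bracket[OF gens] presented_simps .
qed (erule sl_b_gen_closed | rule sl_b_bracket_relation; assumption)+

text \<open>The chains with \<open>d = 0\<close> are the generators, and
  \<open>bracket_span_chains\<close> gives the stability that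
  \<open>presented_subset_submodule\<close> asks for.\<close>

lemma sl_b_spanned_by_chains:
  "carrier (sl_b n b) \<subseteq> LinearCombinations.module.span class_ring (sl_b n b)
    {lie_chain (sl_b n b) (sl_b_gen n b) d p | d p. 1 \<le> p \<and> p + d \<le> n - 1}"
proof -
  interpret serre_deformation "sl_b n b" "n - 1" "sl_b_gen n b" b
    by (rule sl_b_serre_deformation)
  have "carrier (sl_b n b) \<subseteq> span (chains_from 1)"
    using submodule_chains_from[of 1] chain_in_span[of 1 _ 0] bracket_span_chains
    unfolding sl_b_def sl_b_gen_def
    by (intro presented_subset_submodule) auto
  then show ?thesis unfolding chains_from_def .
qed

text \<open>That the assignments define a homomorphism is expressed as existence and uniqueness;
  functions are total, so uniqueness means agreement on the carrier.\<close>

theorem theorem2p3: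
  fixes n k :: nat and a b :: "nat \<Rightarrow> complex"
  assumes "k \<in> {1..n-1}"
    and "\<forall>i \<in> {1..n-2}. b i = - a i * a (i + 1)"
    and "b 0 = 0" and "b (n - 1) = 0"
  shows "\<exists>\<phi> \<in> lie_hom class_ring (sl_b n b) (sl n).
      (\<forall>i \<in> {1..n-1}. \<phi> (sl_b_gen n b i) = gen_image n k b i) \<and>
      (\<forall>\<psi> \<in> lie_hom class_ring (sl_b n b) (sl n).
        (\<forall>i \<in> {1..n-1}. \<psi> (sl_b_gen n b i) = gen_image n k b i) \<longrightarrow>
        (\<forall>x \<in> carrier (sl_b n b). \<psi> x = \<phi> x)) \<and>
      inj_on \<phi> (carrier (sl_b n b))"
proof -
  let ?L = "sl_b n b" and ?u = "sl_b_gen n b" and ?g = "gen_image n k b"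
  have "\<exists>\<phi> \<in> lie_hom class_ring ?L (sl n). \<forall>i \<in> {1..n-1}. \<phi> (?u i) = ?g i"
    unfolding sl_b_def sl_b_gen_def
  proof (rule presented_hom_exists[OF sl_is_lie_algebra])
    fix i assume "i \<in> {1..n-1}"
    then show "?g i \<in> carrier (sl n)" by (rule gen_image_closed[OF assms(1)])
  next
    fix s t assume "(s, t) \<in> sl_b_relations n b"
    then show "lie_eval (sl n) ?g s = lie_eval (sl n) ?g t"
      unfolding sl_b_relations_def
      by (elim UnE CollectE exE conjE Pair_inject)
        (simp_all only: lie_eval.simps gen_image_commute[OF assms(1)] gen_image_serre[OF assms(1)])
  qed
  then obtain \<phi> where \<phi>: "\<phi> \<in> lie_hom class_ring ?L (sl n)"
    and \<phi>_gen: "\<And>i. i \<in> {1..n-1} \<Longrightarrow> \<phi> (?u i) = ?g i" by blast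
  interpret L: serre_deformation ?L "n - 1" ?u b by (rule sl_b_serre_deformation)
  interpret S: lie_algebra "class_ring :: complex ring" "sl n" by (rule sl_is_lie_algebra)
  interpret \<phi>: mod_hom class_ring ?L "sl n" \<phi>
    using \<phi> by unfold_locales (simp add: lie_hom_def)

  have "inj_on \<phi> (carrier ?L)"
  proof (rule inj_onI)
    fix x y assume xy: "x \<in> carrier ?L" "y \<in> carrier ?L" "\<phi> x = \<phi> y"
    define z where "z = x \<ominus>\<^bsub>?L\<^esub> y"
    have z: "z \<in> carrier ?L" using xy by (simp add: z_def)
    have "\<phi> z = \<zero>\<^bsub>sl n\<^esub>"
      using xy lie_homD(1)[OF \<phi> xy(2)] by (simp add: z_def S.M.minus_eq S.M.r_neg)
    then have \<phi>z: "\<phi> z = 0\<^sub>m n n" by (simp add: sl_def)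
    define P where "P = {(d, p). 1 \<le> p \<and> p + d \<le> n - 1}"
    define v where "v = (\<lambda>(d, p). lie_chain ?L ?u d p)"
    \<comment> \<open>The functional reads the leading entry of the image of
      \<open>v (d, p)\<close>: position \<open>(p, p + d + 1)\<close> when indices start from 1. The
      diagonal \<open>d\<close> serves as the rank.\<close>
    define h where "h = (\<lambda>(d, p) x. \<phi> x $$ (p - 1, p + d))"
    have "P \<subseteq> {..n} \<times> {..n}" by (auto simp: P_def)
    then have P: "finite P" by (rule finite_subset) simp
    have \<phi>_dim: "\<phi> x \<in> carrier_mat n n" if "x \<in> carrier ?L" for x
      using lie_homD(1)[OF \<phi> that] by (simp add: sl_def)
    \<comment> \<open>For \<open>e \<le> d\<close> the entry read lies on or above the leading
      diagonal of the chain image, where \<open>lie_chain_gen_image_top\<close> determines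
      it.\<close>
    have h_v: "h (d, p) (v (e, q)) = (if (e, q) = (d, p) then 1 else 0)"
      if "(d, p) \<in> P" "(e, q) \<in> P" "e \<le> d" for d p e q
    proof -
      have pq: "1 \<le> p" "p + d \<le> n - 1" "1 \<le> q" "q + e \<le> n - 1"
        using that by (simp_all add: P_def)
      have "\<phi> (lie_chain ?L ?u e q) = lie_chain (sl n) ?g e q"
        using pq by (intro lie_hom_chain[OF \<phi> \<phi>_gen L.chain_closed])
      moreover have "lie_chain (sl n) ?g e q $$ (p - 1, p + d + 1 - 1) =
          (if p = q \<and> p + d + 1 = q + e + 1 then 1 else 0)"
        using pq \<open>e \<le> d\<close> by (intro lie_chain_gen_image_top[OF assms(1)]) linarith+
      ultimately show ?thesis
        by (auto simp: h_def v_def)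
    qed
    have "z = \<zero>\<^bsub>?L\<^esub>"
    proof (rule triangular_functionals_separate_span[where P = P and v = v and h = h and rank = fst])
      show "Module.module class_ring ?L" by (rule L.module_axioms)
      show "finite P" by (rule P)
      show "v p \<in> carrier ?L" if "p \<in> P" for p
        using that L.chain_closed by (auto simp: P_def v_def)
      show "h p (x \<oplus>\<^bsub>?L\<^esub> y) = h p x + h p y"
        if "p \<in> P" "x \<in> carrier ?L" "y \<in> carrier ?L" for p x y
        using that(1) lie_homD(2)[OF \<phi> that(2,3)] \<phi>_dim[OF that(2)] \<phi>_dim[OF that(3)]
        by (auto simp: P_def h_def sl_def)
      show "h p (c \<odot>\<^bsub>?L\<^esub> x) = c * h p x" if "p \<in> P" "x \<in> carrier ?L" for p c x
        using that(1) lie_homD(3)[OF \<phi> _ that(2), of c] \<phi>_dim[OF that(2)]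
        by (auto simp: P_def h_def sl_def)
      show "h p (v p) \<noteq> 0" if "p \<in> P" for p
        using that h_v[of "fst p" "snd p" "fst p" "snd p"] by simp
      show "h p (v q) = 0" if "p \<in> P" "q \<in> P" "q \<noteq> p" "fst q \<le> fst p" for p q
        using that h_v[of "fst p" "snd p" "fst q" "snd q"] by simp
      have "v ` P = {lie_chain ?L ?u d p | d p. 1 \<le> p \<and> p + d \<le> n - 1}"
        by (auto simp: v_def P_def)
      then show "z \<in> LinearCombinations.module.span class_ring ?L (v ` P)"
        using subsetD[OF sl_b_spanned_by_chains z] by simp
      show "h p z = 0" if "p \<in> P" for p
        using that by (auto simp: h_def P_def \<phi>z)
    qed
    then show "x = y"
      using xy L.M.minus_equality[of x "\<ominus>\<^bsub>?L\<^esub> y"] by (simp add: z_def L.M.minus_eq)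
  qed
  moreover have "\<psi> x = \<phi> x"
    if "\<psi> \<in> lie_hom class_ring ?L (sl n)" "\<forall>i \<in> {1..n-1}. \<psi> (?u i) = ?g i" "x \<in> carrier ?L" for \<psi> x
    using that(1) \<phi> _ that(3) unfolding sl_b_def
  proof (rule presented_hom_unique[OF sl_is_lie_algebra])
    fix i assume "i \<in> {1..n-1}"
    then show "\<psi> (presented_gen {1..n-1} (sl_b_relations n b) i) =
        \<phi> (presented_gen {1..n-1} (sl_b_relations n b) i)"
      using that(2) \<phi>_gen by (metis sl_b_gen_def)
  qed
  ultimately show ?thesis using \<phi> \<phi>_gen by blast
qed

end
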